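(* Suppose that $(X,f)$ and $(Y,g)$ satisfy Axioms 3, 4, 5 (and the standing Axioms 0 and 1), and that they are shift equivalent to each other with lag $m$ by graph maps $r\colon X\to Y$ and $s\colon Y\to X$. Then the conjugacy $\overline r\colon\overline X\to\overline Y$, $\overline r(x_0,x_1,\dots)=(r(x_m),r(x_{m+1}),\dots)$, lifts to a unique conjugacy $\tilde r$ of $(\Sigma_X,\sigma_X)$ and $(\Sigma_Y,\sigma_Y)$, i.e. a conjugacy with $p_Y\circ\tilde r=\overline r\circ p_X$.
   Context: **Graphs and axioms.** $X$ is a (finite) directed graph, regarded as a topological space, with vertex set $\mathcal V$ and edge set $\mathcal E$, and $f\colon X\to X$ is continuous (similarly $(Y,g)$). A graph map is a continuous map sending vertices to vertices. Axiom 0 (Indecomposability): $X$ cannot be split into two nonempty, closed, $f$-invariant subsets. Axiom 1 (Nonwandering): all points of $X$ are nonwandering under $f$. Axiom 3 (Expansion): there are a metric $d$ compatible with the topology and constants $C>0$, $\lambda>1$ such that for all $n>0$ and all points $x,y$ on a common edge of $X$, if $f^n$ maps the interval $[x,y]$ into an edge, then $d(f^nx,f^ny)\ge C\lambda^n d(x,y)$. Axiom 4 (Nonfolding): $f^n|_{X-\mathcal V}$ is locally one-to-one for every positive integer $n$. Axiom 5 (Markov): $f(\mathcal V)\subseteq\mathcal V$. **Inverse limit.** $\overline X=\{(x_0,x_1,\dots): x_i\in X,\ f(x_{i+1})=x_i\}$, $\overline f(x_0,x_1,\dots)=(f(x_0),x_0,x_1,\dots)$, and $\pi(x_0,x_1,\dots)=x_0$.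 **Shift equivalence.** $f$ and $g$ are shift equivalent with lag $m$ (a positive integer) by continuous maps $r\colon X\to Y$, $s\colon Y\to X$ if $r\circ f=g\circ r$, $f\circ s=s\circ g$, $f^m=s\circ r$, $g^m=r\circ s$. **SFT cover.** Each edge $e_i$ of $X$ is partitioned into consecutive subintervals $I_{i,1},\dots,I_{i,j(i)}$ such that $f$ is injective on the interior of $I_{i,j}$ and $f(I_{i,j})$ is an edge (up to direction). Let $\mathcal A=\{I_{i,j}\}$. $\Sigma_X\subset\mathcal A^{\mathbb Z}$ is the set of sequences $(I_{a(k)})_{k\in\mathbb Z}$ with $I_{a(k+1)}\subseteq f(I_{a(k)})$ for all $k$, and $\sigma_X$ is the shift map. The semiconjugacy $p_X\colon\Sigma_X\to\overline X$ sends $w=(I_{a(k)})$ to the unique corresponding point $x_w=(x_0,x_1,\dots)=\bigcap_{j=-\infty}^{\infty}\overline{\overline f^{-j}(\pi^{-1}(I_{a(j)}))}$, for which $x_i\in I_{a(-i)}$ and $f^i(x_0)\in I_{a(i)}$ for $i\ge0$. $(\Sigma_Y,\sigma_Y)$ and $p_Y$ are defined in the same way from $(Y,g)$. *)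

theory Defs
  imports "HOL-Analysis.Analysis"
begin

text \<open>
  A finite directed graph is realized as a subspace of a Hausdorff space. An edge is given by its
  characteristic map on \<open>[0,1]\<close>, directed by increasing parameter. Loops, multiple edges and
  isolated vertices are allowed. Since \<open>V\<close> and \<open>E\<close> are finite and the ambient space is
  Hausdorff, the subspace topology is the usual quotient topology of the graph.
\<close>

record 'a top_graph =
  verts :: "'a set"
  edges :: "(real \<Rightarrow> 'a) set"

definition space_of :: "'a::t2_space top_graph \<Rightarrow> 'a set" where
  "space_of G = verts G \<union> (\<Union>e\<in>edges G. path_image e)"

definition top_graph :: "'a::t2_space top_graph \<Rightarrow> bool" where
  "top_graph G \<longleftrightarrow>
     finite (verts G) \<and> finite (edges G) \<and>
     (\<forall>e\<in>edges G. simple_path e \<and> pathstart e \<in> verts G \<and> pathfinish e \<in> verts G \<and>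
        e ` {0<..<1} \<inter> verts G = {}) \<and>
     (\<forall>e\<in>edges G. \<forall>e'\<in>edges G. e \<noteq> e' \<longrightarrow> e ` {0<..<1} \<inter> e' ` {0<..<1} = {})"

definition continuous_between ::
    "'a::t2_space top_graph \<Rightarrow> 'b::t2_space top_graph \<Rightarrow> ('a \<Rightarrow> 'b) \<Rightarrow> bool" where
  "continuous_between G H r \<longleftrightarrow>
     continuous_on (space_of G) r \<and> r ` space_of G \<subseteq> space_of H"

definition graph_map ::
    "'a::t2_space top_graph \<Rightarrow> 'b::t2_space top_graph \<Rightarrow> ('a \<Rightarrow> 'b) \<Rightarrow> bool" where
  "graph_map G H r \<longleftrightarrow> continuous_between G H r \<and> r ` verts G \<subseteq> verts H"

definition indecomposable :: "'a::t2_space top_graph \<Rightarrow> ('a \<Rightarrow> 'a) \<Rightarrow> bool" where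
  "indecomposable G f \<longleftrightarrow>
     \<not> (\<exists>A B. A \<noteq> {} \<and> B \<noteq> {} \<and> A \<union> B = space_of G \<and> A \<inter> B = {} \<and>
          closedin (top_of_set (space_of G)) A \<and> closedin (top_of_set (space_of G)) B \<and>
          f ` A \<subseteq> A \<and> f ` B \<subseteq> B)"

definition nonwandering :: "'a::t2_space top_graph \<Rightarrow> ('a \<Rightarrow> 'a) \<Rightarrow> bool" where
  "nonwandering G f \<longleftrightarrow>
     (\<forall>x\<in>space_of G. \<forall>U. openin (top_of_set (space_of G)) U \<and> x \<in> U \<longrightarrow>
        (\<exists>n>0. (f ^^ n) ` U \<inter> U \<noteq> {}))"

text \<open>
  Points on a common edge \<open>e\<close> are \<open>e s\<close> and \<open>e t\<close>, and the interval between them is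
  \<open>e ` {s..t}\<close>; edges are closed.
\<close>

definition expansion :: "'a::t2_space top_graph \<Rightarrow> ('a \<Rightarrow> 'a) \<Rightarrow> bool" where
  "expansion G f \<longleftrightarrow>
     (\<exists>d C lam. Metric_space (space_of G) d \<and>
        Metric_space.mtopology (space_of G) d = top_of_set (space_of G) \<and>
        C > 0 \<and> lam > (1::real) \<and>
        (\<forall>n>0. \<forall>e\<in>edges G. \<forall>e'\<in>edges G. \<forall>s\<in>{0..1}. \<forall>t\<in>{0..1}.
           s \<le> t \<and> (f ^^ n) ` (e ` {s..t}) \<subseteq> path_image e' \<longrightarrow>
           d ((f ^^ n) (e s)) ((f ^^ n) (e t)) \<ge> C * lam ^ n * d (e s) (e t)))"

definition nonfolding :: "'a::t2_space top_graph \<Rightarrow> ('a \<Rightarrow> 'a) \<Rightarrow> bool" where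
  "nonfolding G f \<longleftrightarrow>
     (\<forall>n>0. \<forall>x\<in>space_of G - verts G.
        \<exists>U. openin (top_of_set (space_of G - verts G)) U \<and> x \<in> U \<and> inj_on (f ^^ n) U)"

definition markov :: "'a::t2_space top_graph \<Rightarrow> ('a \<Rightarrow> 'a) \<Rightarrow> bool" where
  "markov G f \<longleftrightarrow> f ` verts G \<subseteq> verts G"

definition expanding_graph_system :: "'a::t2_space top_graph \<Rightarrow> ('a \<Rightarrow> 'a) \<Rightarrow> bool" where
  "expanding_graph_system G f \<longleftrightarrow>
     top_graph G \<and> continuous_between G G f \<and>
     indecomposable G f \<and> nonwandering G f \<and> expansion G f \<and> nonfolding G f \<and> markov G f"

definition shift_equivalent_by ::
    "'a::t2_space top_graph \<Rightarrow> ('a \<Rightarrow> 'a) \<Rightarrow> 'b::t2_space top_graph \<Rightarrow> ('b \<Rightarrow> 'b) \<Rightarrow> nat \<Rightarrow>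
     ('a \<Rightarrow> 'b) \<Rightarrow> ('b \<Rightarrow> 'a) \<Rightarrow> bool" where
  "shift_equivalent_by G f H g m r s \<longleftrightarrow>
     m > 0 \<and> continuous_between G H r \<and> continuous_between H G s \<and>
     (\<forall>x\<in>space_of G. r (f x) = g (r x)) \<and>
     (\<forall>y\<in>space_of H. f (s y) = s (g y)) \<and>
     (\<forall>x\<in>space_of G. (f ^^ m) x = s (r x)) \<and>
     (\<forall>y\<in>space_of H. (g ^^ m) y = r (s y))"

definition conjugacy ::
    "'a topology \<Rightarrow> ('a \<Rightarrow> 'a) \<Rightarrow> 'b topology \<Rightarrow> ('b \<Rightarrow> 'b) \<Rightarrow> ('a \<Rightarrow> 'b) \<Rightarrow> bool" where
  "conjugacy S F T F' h \<longleftrightarrow>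
     homeomorphic_map S T h \<and> (\<forall>x\<in>topspace S. h (F x) = F' (h x))"

text \<open>The function type \<open>nat \<Rightarrow> 'a\<close> carries the product topology.\<close>

definition inv_limit :: "'a::t2_space top_graph \<Rightarrow> ('a \<Rightarrow> 'a) \<Rightarrow> (nat \<Rightarrow> 'a) set" where
  "inv_limit G f = {x. \<forall>i. x i \<in> space_of G \<and> f (x (Suc i)) = x i}"

definition inv_limit_map :: "('a \<Rightarrow> 'a) \<Rightarrow> (nat \<Rightarrow> 'a) \<Rightarrow> nat \<Rightarrow> 'a" where
  "inv_limit_map f x = case_nat (f (x 0)) x"

definition inv_limit_iter ::
    "'a::t2_space top_graph \<Rightarrow> ('a \<Rightarrow> 'a) \<Rightarrow> int \<Rightarrow> (nat \<Rightarrow> 'a) \<Rightarrow> nat \<Rightarrow> 'a" where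
  "inv_limit_iter G f j =
     (if j \<ge> 0 then inv_limit_map f ^^ nat j
      else inv_into (inv_limit G f) (inv_limit_map f) ^^ nat (- j))"

definition induced_map :: "nat \<Rightarrow> ('a \<Rightarrow> 'b) \<Rightarrow> (nat \<Rightarrow> 'a) \<Rightarrow> nat \<Rightarrow> 'b" where
  "induced_map m r x = (\<lambda>i. r (x (m + i)))"

definition edge_partition ::
    "'a::t2_space top_graph \<Rightarrow> ('a \<Rightarrow> 'a) \<Rightarrow> (real \<Rightarrow> 'a) \<Rightarrow> 'a set set \<Rightarrow> bool" where
  "edge_partition G f e P \<longleftrightarrow>
     (\<exists>(k::nat) t. t 0 = 0 \<and> t k = 1 \<and>
        (\<forall>i<k. t i < t (Suc i) \<and> inj_on f (e ` {t i<..<t (Suc i)}) \<and>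
           (\<exists>e'\<in>edges G. f ` (e ` {t i..t (Suc i)}) = path_image e')) \<and>
        P = (\<lambda>i. e ` {t i..t (Suc i)}) ` {..<k})"

text \<open>
  The alphabet of the SFT cover: its letters are the closed subintervals themselves. For a
  nonfolding Markov map the division points of an edge are its points mapped to vertices, so there
  is only one such alphabet.
\<close>

definition sft_alphabet :: "'a::t2_space top_graph \<Rightarrow> ('a \<Rightarrow> 'a) \<Rightarrow> 'a set set \<Rightarrow> bool" where
  "sft_alphabet G f A \<longleftrightarrow>
     (\<exists>P. (\<forall>e\<in>edges G. edge_partition G f e (P e)) \<and> A = (\<Union>e\<in>edges G. P e))"

definition sft :: "('a \<Rightarrow> 'a) \<Rightarrow> 'a set set \<Rightarrow> (int \<Rightarrow> 'a set) set" where
  "sft f A = {w. \<forall>k. w k \<in> A \<and> w (k + 1) \<subseteq> f ` w k}"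

definition sft_topology :: "('a \<Rightarrow> 'a) \<Rightarrow> 'a set set \<Rightarrow> (int \<Rightarrow> 'a set) topology" where
  "sft_topology f A = subtopology (product_topology (\<lambda>_. discrete_topology A) UNIV) (sft f A)"

definition shift_map :: "(int \<Rightarrow> 'b) \<Rightarrow> int \<Rightarrow> 'b" where
  "shift_map w = (\<lambda>k. w (k + 1))"

text \<open>
  The preimage of \<open>\<pi>\<inverse>(w j)\<close> under the \<open>j\<close>-th iterate of the inverse limit homeomorphism,
  for each integer \<open>j\<close>.
\<close>

definition cylinder ::
    "'a::t2_space top_graph \<Rightarrow> ('a \<Rightarrow> 'a) \<Rightarrow> (int \<Rightarrow> 'a set) \<Rightarrow> int \<Rightarrow> (nat \<Rightarrow> 'a) set" where
  "cylinder G f w j = {x \<in> inv_limit G f. inv_limit_iter G f j x 0 \<in> w j}"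

definition cover_map ::
    "'a::t2_space top_graph \<Rightarrow> ('a \<Rightarrow> 'a) \<Rightarrow> (int \<Rightarrow> 'a set) \<Rightarrow> nat \<Rightarrow> 'a" where
  "cover_map G f w =
     (THE x. x \<in> (\<Inter>j. top_of_set (inv_limit G f) closure_of cylinder G f w j))"

end

theory Submission
  imports Defs
begin

text \<open>
  Expansion makes \<open>f\<close> injective on the closed letters and rules out loops: the letter mapped onto a
  loop is itself a whole loop, so a loop has preimage loops of every order, and the expansion along
  these contradicts compactness. Hence the points of a finite itinerary \<open>w 0, \<dots>, w n\<close> form an arc
  mapped homeomorphically onto an edge by the \<open>(n+1)\<close>-st iterate, and an infinite itinerary
  determines a unique point. Since \<open>s\<close> maps vertices to vertices and \<open>s \<circ> r = f\<^sup>m\<close>, the map \<open>r\<close>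
  sends the interior of the arc of \<open>w (k - m), \<dots>, w k\<close> to points that \<open>g\<close> does not map to a vertex;
  being connected, the image lies in a single letter of \<open>Y\<close>. This letter is coordinate \<open>k\<close> of the lift.
  The lift built from \<open>s\<close> in the same way inverts it up to \<open>m\<close> shifts, because two letters sharing
  infinitely many points coincide. The same principle gives uniqueness: near \<open>w\<close> a continuous lift
  has constant coordinate \<open>0\<close>, while the points \<open>x\<^sub>0\<close> covered there fill an arc.
\<close>

section \<open>Injective images of compact sets\<close>

text \<open>A continuous injection of a compact set into a Hausdorff space has a continuous inverse,
  and the set in question is the image of \<open>C\<close> under it.\<close>

lemma connected_preimage_of_compact_inj:
  fixes k :: "'a::topological_space \<Rightarrow> 'b::t2_space"
  assumes "compact K" "continuous_on K k" "inj_on k K" "connected C" "C \<subseteq> k ` K"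
  shows "connected {x \<in> K. k x \<in> C}"
proof -
  have "continuous_on (k ` K) (inv_into K k)"
    using assms by (intro continuous_on_inv) auto
  then have "connected (inv_into K k ` C)"
    using assms by (meson connected_continuous_image continuous_on_subset)
  moreover have "inv_into K k ` C = {x \<in> K. k x \<in> C}"
  proof (intro equalityI subsetI)
    fix x assume "x \<in> inv_into K k ` C"
    then show "x \<in> {x \<in> K. k x \<in> C}"
      using assms(5) by (auto simp: f_inv_into_f inv_into_into subset_eq)
  next
    fix x assume x: "x \<in> {x \<in> K. k x \<in> C}"
    then have "x = inv_into K k (k x)"
      using assms(3) by simp
    then show "x \<in> inv_into K k ` C"
      using x by blast
  qed
  ultimately show ?thesis by simp
qed

text \<open>The finite set \<open>F - b\<close> is closed, so it and \<open>b\<close> would split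
  \<open>J\<close>; infinity of \<open>J\<close> makes \<open>b\<close> the piece that is
  met.\<close>

lemma connected_closed_cofinite:
  fixes J :: "'a::t1_space set"
  assumes "connected J" "infinite J" "finite F" "closed b" "J - F \<subseteq> b"
  shows "J \<subseteq> b"
proof -
  have "b \<inter> (F - b) \<inter> J = {}" "J \<subseteq> b \<union> (F - b)" "closed (F - b)"
    using assms by (auto intro: finite_imp_closed)
  then have "b \<inter> J = {} \<or> (F - b) \<inter> J = {}"
    using connected_closedD assms by blast
  moreover have "b \<inter> J \<noteq> {}"
    using assms by (metis Diff_eq_empty_iff Int_commute bot.extremum_uniqueI finite_subset inf.absorb_iff2 inf_bot_right Diff_subset le_inf_iff order_refl)
  ultimately show ?thesis using assms by blast
qed

lemma real_connected_betweenI: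
  fixes C :: "real set"
  assumes "connected C" "a \<in> C" "b \<in> C" "a \<le> c" "c \<le> b"
  shows "c \<in> C"
  using connected_contains_Icc[OF assms(1-3)] assms(4,5) by auto

text \<open>Deleting an interior point disconnects an interval but not a loop. The argument deletes
  \<open>k c\<close> from the loop and pulls the rest back along \<open>k\<close>.\<close>

lemma arc_image_not_loop:
  fixes k e :: "real \<Rightarrow> 'a::t2_space"
  assumes st: "s < t" and k: "continuous_on {s..t} k" "inj_on k {s..t}"
    and e: "simple_path e" and im: "k ` {s..t} = path_image e"
  shows "e 0 \<noteq> e 1"
proof
  assume loop: "e 0 = e 1"
  have ce: "continuous_on {0..1} e"
    using e by (simp add: simple_path_def path_def)
  have "\<exists>c. s < c \<and> c < t \<and> k c \<noteq> e 0"
  proof (rule ccontr)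
    assume neg: "\<not> ?thesis"
    \<comment> \<open>Two interior points suffice: by injectivity at most one of them goes to the
      base point.\<close>
    define c1 c2 where "c1 = (2 * s + t) / 3" and "c2 = (s + 2 * t) / 3"
    have c: "s < c1" "c1 < t" "s < c2" "c2 < t" "c1 \<noteq> c2"
      using st by (auto simp: c1_def c2_def)
    then have "k c1 = k c2" using neg by metis
    then show False using c k(2) by (auto simp: inj_on_def)
  qed
  then obtain c where c: "s < c" "c < t" "k c \<noteq> e 0" by blast
  then have "k c \<in> path_image e" using im by auto
  then obtain p where p: "0 \<le> p" "p \<le> 1" "k c = e p" by (auto simp: path_image_def)
  with c loop have p01: "0 < p" "p < 1"
    by (metis less_eq_real_def)+
  \<comment> \<open>This is the loop without \<open>e p\<close>: two half-open arcs glued at the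
    base point.\<close>
  define C where "C = e ` {0..<p} \<union> e ` {p<..1}"
  have "connected C"
    unfolding C_def
  proof (rule connected_Un)
    show "connected (e ` {0..<p})" "connected (e ` {p<..1})"
      using p01 by (auto intro!: connected_continuous_image continuous_on_subset[OF ce])
    show "e ` {0..<p} \<inter> e ` {p<..1} \<noteq> {}"
    proof -
      have "e 0 \<in> e ` {0..<p}" "e 1 \<in> e ` {p<..1}" using p01 by auto
      then show ?thesis using loop by auto
    qed
  qed
  moreover have "C \<subseteq> k ` {s..t}"
    unfolding im C_def path_image_def using p01 by auto
  ultimately have con: "connected {u \<in> {s..t}. k u \<in> C}"
    using k by (intro connected_preimage_of_compact_inj) auto
  have notC: "e p \<notin> C"
  proof
    assume "e p \<in> C"
    then obtain q where "q \<in> {0..<p} \<union> {p<..1}" "e q = e p"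
      unfolding C_def by force
    then show False
      using e p01 unfolding simple_path_def loop_free_def by force
  qed
  have C: "x \<in> C" if x: "x \<in> path_image e" "x \<noteq> e p" for x
  proof -
    obtain q where q: "x = e q" "0 \<le> q" "q \<le> 1" using x(1) by (auto simp: path_image_def)
    then have "q \<in> {0..<p} \<union> {p<..1}" using x(2) by (cases q p rule: linorder_cases) auto
    then show ?thesis unfolding C_def q(1) by blast
  qed
  have "k s \<noteq> k c" "k t \<noteq> k c"
    using c st inj_onD[OF k(2), of _ c] by force+
  then have "k s \<in> C" "k t \<in> C"
    using C[of "k s"] C[of "k t"] im[symmetric] p(3) st by auto
  then have "c \<in> {u \<in> {s..t}. k u \<in> C}"
    using real_connected_betweenI[OF con, of s t c] c st by auto
  then show False using notC p by auto
qed

text \<open>Deleting the end \<open>u\<close> leaves the interval connected, whereas deleting an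
  interior point \<open>e p\<close> would cut the arc \<open>e\<close> in two.\<close>

lemma arc_image_endpoint:
  fixes k e :: "real \<Rightarrow> 'a::t2_space"
  assumes st: "s < t" and k: "continuous_on {s..t} k" "inj_on k {s..t}"
    and e: "path e" "inj_on e {0..1}" and im: "k ` {s..t} = path_image e"
    and u: "u = s \<or> u = t"
  shows "k u \<in> {e 0, e 1}"
proof (rule ccontr)
  assume neg: "k u \<notin> {e 0, e 1}"
  have "k u \<in> path_image e" using im u st by auto
  then obtain p where p: "0 \<le> p" "p \<le> 1" "k u = e p" by (auto simp: path_image_def)
  with neg have p01: "0 < p" "p < 1"
    by (metis insertCI less_eq_real_def)+
  define C where "C = k ` ({s..t} - {u})"
  have "{s..t} - {u} = {s<..t} \<or> {s..t} - {u} = {s..<t}"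
    using u st by auto
  then have "connected ({s..t} - {u})"
    by (elim disjE) (simp_all only: connected_Ioc connected_Ico)
  then have "connected C"
    unfolding C_def by (intro connected_continuous_image continuous_on_subset[OF k(1)]) auto
  moreover have "C \<subseteq> e ` {0..1}"
    using im by (auto simp: C_def path_image_def)
  ultimately have con: "connected {q \<in> {0..1}. e q \<in> C}"
    using e by (intro connected_preimage_of_compact_inj) (auto simp: path_def)
  have C: "C = path_image e - {e p}"
    unfolding C_def p(3)[symmetric] im[symmetric] using u st k(2) by (auto simp: inj_on_def)
  have "e 0 \<in> C" "e 1 \<in> C"
    unfolding C path_image_def using p01 inj_onD[OF e(2), of _ p] by force+
  then have "p \<in> {q \<in> {0..1}. e q \<in> C}"
    using real_connected_betweenI[OF con, of 0 1 p] p by auto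
  then show False using C by auto
qed

lemma partition_mono:
  fixes t :: "nat \<Rightarrow> real"
  assumes "\<And>i. i < k \<Longrightarrow> t i < t (Suc i)" "i \<le> j" "j \<le> k"
  shows "t i \<le> t j"
  using assms(2,3)
proof (induction j rule: dec_induct)
  case (step j)
  then show ?case using assms(1)[of j] by auto
qed simp

lemma partition_covers:
  fixes t :: "nat \<Rightarrow> real"
  assumes "t 0 \<le> u" "u \<le> t k" "0 < k"
  shows "\<exists>i<k. t i \<le> u \<and> u \<le> t (Suc i)"
  using assms(2,3)
proof (induction k)
  case (Suc k)
  show ?case
  proof (cases "k = 0 \<or> t k \<le> u")
    case True
    then show ?thesis using Suc assms(1) by auto
  next
    case False
    then show ?thesis using Suc by (metis less_Suc_eq linear gr0I)
  qed
qed simp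

section \<open>Letters of the cover\<close>

locale graph_cover =
  fixes G :: "'a::t2_space top_graph" and f :: "'a \<Rightarrow> 'a" and A :: "'a set set"
  assumes sys: "expanding_graph_system G f" and alph: "sft_alphabet G f A"
begin

lemma is_top_graph: "top_graph G"
  using sys unfolding expanding_graph_system_def by (elim conjE)

lemma finite_verts: "finite (verts G)" and finite_edges: "finite (edges G)"
  using is_top_graph unfolding top_graph_def by blast+

lemma
  assumes "e \<in> edges G"
  shows edge_simple: "simple_path e"
    and edge_ends: "e 0 \<in> verts G" "e 1 \<in> verts G"
    and edge_interior: "e ` {0<..<1} \<inter> verts G = {}"
  using is_top_graph assms unfolding top_graph_def pathstart_def pathfinish_def by blast+

lemma edges_disjoint:
  "e \<in> edges G \<Longrightarrow> e' \<in> edges G \<Longrightarrow> e \<noteq> e' \<Longrightarrow> e ` {0<..<1} \<inter> e' ` {0<..<1} = {}"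
  using is_top_graph unfolding top_graph_def by (elim conjE) blast

lemma cont: "continuous_on (space_of G) f" and map_space: "f ` space_of G \<subseteq> space_of G"
  using sys unfolding expanding_graph_system_def continuous_between_def by auto

lemma map_verts: "x \<in> verts G \<Longrightarrow> f x \<in> verts G"
  using sys unfolding expanding_graph_system_def markov_def by auto

lemma edge_path: "e \<in> edges G \<Longrightarrow> path e"
  using edge_simple by (auto simp: simple_path_def)

lemma edge_cont: "e \<in> edges G \<Longrightarrow> continuous_on {0..1} e"
  using edge_path by (auto simp: path_def)

lemma edge_subset: "e \<in> edges G \<Longrightarrow> path_image e \<subseteq> space_of G"
  by (auto simp: space_of_def)

lemma compact_space: "compact (space_of G)"
  unfolding space_of_def
  using finite_verts finite_edges edge_path
  by (intro compact_Un compact_UN finite_imp_compact compact_path_image)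

lemma iter_space: "x \<in> space_of G \<Longrightarrow> (f ^^ n) x \<in> space_of G"
  using map_space by (induction n) auto

lemma iter_cont: "continuous_on (space_of G) (f ^^ n)"
proof (induction n)
  case (Suc n)
  have "continuous_on (space_of G) (\<lambda>x. f ((f ^^ n) x))"
    using continuous_on_compose2[OF cont Suc] iter_space by blast
  then show ?case by (simp add: o_def)
qed simp

lemma edge_minus_verts:
  assumes "e \<in> edges G" shows "path_image e - verts G = e ` {0<..<1}"
proof -
  have "{0..1::real} = {0,1} \<union> {0<..<1}" by auto
  then have "path_image e = {e 0, e 1} \<union> e ` {0<..<1}"
    unfolding path_image_def by (metis image_Un image_insert image_empty)
  then show ?thesis
    using edge_ends[OF assms] edge_interior[OF assms] by auto
qed

lemma edge_unique:
  assumes "e \<in> edges G" "e' \<in> edges G" "x \<in> path_image e" "x \<in> path_image e'" "x \<notin> verts G"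
  shows "e = e'"
  using edges_disjoint[OF assms(1,2)] edge_minus_verts[OF assms(1)] edge_minus_verts[OF assms(2)] assms
  by blast

section \<open>Division points and elementary properties of letters\<close>

definition division :: "(real \<Rightarrow> 'a) \<Rightarrow> nat \<Rightarrow> (nat \<Rightarrow> real) \<Rightarrow> bool" where
  "division e k t \<longleftrightarrow> t 0 = 0 \<and> t k = 1 \<and>
     (\<forall>i<k. t i < t (Suc i) \<and> (\<exists>e'\<in>edges G. f ` (e ` {t i..t (Suc i)}) = path_image e'))"

lemma division_mono: "division e k t \<Longrightarrow> i \<le> j \<Longrightarrow> j \<le> k \<Longrightarrow> t i \<le> t j"
  by (rule partition_mono[where k=k]) (auto simp: division_def)

lemma division_bounds:
  assumes "division e k t" "i < k"
  shows "0 \<le> t i" "t i < t (Suc i)" "t (Suc i) \<le> 1"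
  using division_mono[OF assms(1), of 0 i] division_mono[OF assms(1), of "Suc i" k] assms
  by (auto simp: division_def)

text \<open>Choosing one cut sequence per edge turns letters into pairs of an edge and an index, so
  that they can be compared through parameters.\<close>

lemma letters_partition:
  obtains K T where "\<forall>e\<in>edges G. division e (K e) (T e)"
    "A = (\<Union>e\<in>edges G. (\<lambda>i. e ` {T e i..T e (Suc i)}) ` {..<K e})"
proof -
  obtain P where P: "\<forall>e\<in>edges G. edge_partition G f e (P e)" and AP: "A = (\<Union>e\<in>edges G. P e)"
    using alph unfolding sft_alphabet_def by blast
  have "\<forall>e\<in>edges G. \<exists>k t. division e k t \<and> P e = (\<lambda>i. e ` {t i..t (Suc i)}) ` {..<k}"
  proof
    fix e assume "e \<in> edges G"
    then have "edge_partition G f e (P e)" using P by blast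
    then show "\<exists>k t. division e k t \<and> P e = (\<lambda>i. e ` {t i..t (Suc i)}) ` {..<k}"
      unfolding edge_partition_def division_def
      by (elim exE conjE) (intro exI conjI, assumption+, simp_all)
  qed
  from bchoice[OF this] obtain K where
    "\<forall>e\<in>edges G. \<exists>t. division e (K e) t \<and> P e = (\<lambda>i. e ` {t i..t (Suc i)}) ` {..<K e}" ..
  from bchoice[OF this] obtain T where
    "\<forall>e\<in>edges G. division e (K e) (T e) \<and> P e = (\<lambda>i. e ` {T e i..T e (Suc i)}) ` {..<K e}" ..
  then show thesis
    using that[of K T] AP by simp
qed

lemma letterE:
  assumes "a \<in> A"
  obtains e s t where "e \<in> edges G" "0 \<le> s" "s < t" "t \<le> 1" "a = e ` {s..t}"
    "\<exists>e'\<in>edges G. f ` a = path_image e'"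
proof -
  obtain K T where KT: "\<forall>e\<in>edges G. division e (K e) (T e)"
    "A = (\<Union>e\<in>edges G. (\<lambda>i. e ` {T e i..T e (Suc i)}) ` {..<K e})"
    by (rule letters_partition)
  then obtain e i where e: "e \<in> edges G" "i < K e" "a = e ` {T e i..T e (Suc i)}"
    using assms by auto
  have "\<exists>e'\<in>edges G. f ` a = path_image e'"
    using KT(1)[rule_format, OF e(1)] e unfolding division_def by blast
  then show thesis
    using division_bounds[OF KT(1)[rule_format, OF e(1)] e(2)] e that by blast
qed

lemma letter_image: "a \<in> A \<Longrightarrow> \<exists>e\<in>edges G. f ` a = path_image e"
  by (meson letterE)

lemma letter_in_edge: "a \<in> A \<Longrightarrow> \<exists>e\<in>edges G. a \<subseteq> path_image e"
  by (elim letterE) (force simp: path_image_def)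

lemma letter_subset: "a \<in> A \<Longrightarrow> a \<subseteq> space_of G"
  using letter_in_edge edge_subset by blast

lemma letter_compact: "a \<in> A \<Longrightarrow> compact a"
  by (elim letterE) (auto intro!: compact_continuous_image continuous_on_subset[OF edge_cont])

lemma letter_closed: "a \<in> A \<Longrightarrow> closed a"
  using letter_compact compact_imp_closed by blast

lemma edge_inj_open: "e \<in> edges G \<Longrightarrow> inj_on e {0<..<1}"
  using edge_simple[of e] by (force simp: simple_path_def loop_free_def inj_on_def)

lemma edge_interior_infinite:
  assumes "e \<in> edges G" shows "infinite (path_image e - verts G)"
  unfolding edge_minus_verts[OF assms]
  using finite_image_iff[OF edge_inj_open[OF assms]] by (auto simp: infinite_Ioo)

lemma letter_infinite:
  assumes "a \<in> A" shows "infinite a"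
proof -
  obtain e where "e \<in> edges G" "f ` a = path_image e" using letter_image assms by blast
  then show ?thesis
    using edge_interior_infinite by (metis finite_Diff finite_imageI)
qed

lemma finite_letters: "finite A"
proof -
  obtain K T where "\<forall>e\<in>edges G. division e (K e) (T e)"
    "A = (\<Union>e\<in>edges G. (\<lambda>i. e ` {T e i..T e (Suc i)}) ` {..<K e})"
    by (rule letters_partition)
  then show ?thesis using finite_edges by auto
qed

lemma edge_covered:
  assumes "e \<in> edges G" "x \<in> path_image e"
  shows "\<exists>a\<in>A. x \<in> a \<and> a \<subseteq> path_image e"
proof -
  obtain K T where KT: "\<forall>e\<in>edges G. division e (K e) (T e)"
    "A = (\<Union>e\<in>edges G. (\<lambda>i. e ` {T e i..T e (Suc i)}) ` {..<K e})"
    by (rule letters_partition)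
  have div: "T e 0 = 0" "T e (K e) = 1" "0 < K e"
    using KT(1)[rule_format, OF assms(1)] unfolding division_def by (auto intro: gr0I)
  obtain u where u: "0 \<le> u" "u \<le> 1" "x = e u"
    using assms(2) by (auto simp: path_image_def)
  obtain i where i: "i < K e" "T e i \<le> u" "u \<le> T e (Suc i)"
    using partition_covers[of "T e" u "K e"] div u by auto
  have "e ` {T e i..T e (Suc i)} \<in> A"
    unfolding KT(2) using assms(1) i(1) by auto
  moreover have "x \<in> e ` {T e i..T e (Suc i)}" using u i by auto
  moreover have "e ` {T e i..T e (Suc i)} \<subseteq> path_image e"
    unfolding path_image_def using division_bounds[OF KT(1)[rule_format, OF assms(1)] i(1)]
    by (intro image_mono) auto
  ultimately show ?thesis by blast
qed

lemma letters_cover: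
  assumes "x \<in> space_of G" "x \<notin> verts G"
  shows "\<exists>a\<in>A. x \<in> a"
  using assms edge_covered unfolding space_of_def by blast

lemma successor_letter:
  assumes "a \<in> A" "y \<in> f ` a"
  shows "\<exists>b\<in>A. y \<in> b \<and> b \<subseteq> f ` a"
  using letter_image[OF assms(1)] edge_covered assms(2) by metis

text \<open>A point off the vertices lies on one edge only, so the edge carrying \<open>b\<close>
  must be the edge onto which \<open>a\<close> is mapped.\<close>

lemma successor_letter_if_meets:
  assumes "a \<in> A" "b \<in> A" "x \<in> b" "x \<in> f ` a" "x \<notin> verts G"
  shows "b \<subseteq> f ` a"
  using letter_image[OF assms(1)] letter_in_edge[OF assms(2)] edge_unique assms by (metis subsetD)

section \<open>Consequences of expansion and nonwandering\<close>

text \<open>Compactness bounds the metric by \<open>B\<close>. Hence distances that stay bounded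
  below cannot be expanded by \<open>C * lam ^ n\<close> for all \<open>n\<close>; this is the
  contradiction in \<open>no_loops\<close> and \<open>itinerary_point_unique\<close>.\<close>

lemma expansion_bounded:
  obtains d C lam B where
    "\<forall>x\<in>space_of G. \<forall>y\<in>space_of G. (d x y = 0 \<longleftrightarrow> x = y) \<and> 0 \<le> d x y \<and> d x y \<le> B"
    "C > 0" "lam > (1::real)"
    "\<forall>n e e' s t. n > 0 \<and> e \<in> edges G \<and> e' \<in> edges G \<and> 0 \<le> s \<and> s \<le> t \<and> t \<le> 1 \<and>
       (f ^^ n) ` (e ` {s..t}) \<subseteq> path_image e' \<longrightarrow>
       C * lam ^ n * d (e s) (e t) \<le> d ((f ^^ n) (e s)) ((f ^^ n) (e t))"
proof -
  have "expansion G f"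
    using sys unfolding expanding_graph_system_def by (elim conjE)
  then obtain d C lam where D: "Metric_space (space_of G) d \<and>
        Metric_space.mtopology (space_of G) d = top_of_set (space_of G) \<and>
        C > 0 \<and> lam > (1::real) \<and>
        (\<forall>n>0. \<forall>e\<in>edges G. \<forall>e'\<in>edges G. \<forall>s\<in>{0..1}. \<forall>t\<in>{0..1}.
           s \<le> t \<and> (f ^^ n) ` (e ` {s..t}) \<subseteq> path_image e' \<longrightarrow>
           d ((f ^^ n) (e s)) ((f ^^ n) (e t)) \<ge> C * lam ^ n * d (e s) (e t))"
    unfolding expansion_def by (elim exE) (rule that)
  note M = D[THEN conjunct1] and top = D[THEN conjunct2, THEN conjunct1]
    and CL = D[THEN conjunct2, THEN conjunct2, THEN conjunct1]
      D[THEN conjunct2, THEN conjunct2, THEN conjunct2, THEN conjunct1]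
    and ex = D[THEN conjunct2, THEN conjunct2, THEN conjunct2, THEN conjunct2, rule_format]
  interpret Metric_space "space_of G" d by (rule M)
  have "compactin mtopology (space_of G)"
    unfolding top using compact_space by (simp add: compactin_subtopology)
  then have "mbounded (space_of G)" by (rule compactin_imp_mbounded)
  then obtain B where "\<forall>x\<in>space_of G. \<forall>y\<in>space_of G. d x y \<le> B"
    unfolding mbounded_alt by (elim exE conjE)
  then show thesis
    using CL by (intro that[of d B C lam]) (auto intro: ex)
qed

text \<open>The interval between two points of a letter is mapped into an edge, so expansion with
  \<open>n = 1\<close> applies, end points included: equal images force distance zero.\<close>

lemma letter_inj:
  assumes "a \<in> A" shows "inj_on f a"
proof (rule inj_onI)
  fix x y assume xy: "x \<in> a" "y \<in> a" "f x = f y"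
  obtain e s t where e: "e \<in> edges G" "0 \<le> s" "s < t" "t \<le> 1" "a = e ` {s..t}"
    "\<exists>e'\<in>edges G. f ` a = path_image e'" using assms by (rule letterE)
  then obtain e' where e': "e' \<in> edges G" "f ` a = path_image e'" by blast
  obtain d C lam B where d:
    "\<forall>x\<in>space_of G. \<forall>y\<in>space_of G. (d x y = 0 \<longleftrightarrow> x = y) \<and> 0 \<le> d x y \<and> d x y \<le> B"
    "C > 0" "lam > (1::real)"
    "\<forall>n e e' s t. n > 0 \<and> e \<in> edges G \<and> e' \<in> edges G \<and> 0 \<le> s \<and> s \<le> t \<and> t \<le> 1 \<and>
       (f ^^ n) ` (e ` {s..t}) \<subseteq> path_image e' \<longrightarrow>
       C * lam ^ n * d (e s) (e t) \<le> d ((f ^^ n) (e s)) ((f ^^ n) (e t))"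
    by (rule expansion_bounded)
  have *: "e u = e v" if uv: "u \<in> {s..t}" "v \<in> {s..t}" "u \<le> v" "f (e u) = f (e v)" for u v
  proof (rule ccontr)
    assume ne: "e u \<noteq> e v"
    have sp: "e u \<in> space_of G" "e v \<in> space_of G"
      using uv e letter_subset[OF assms] by auto
    have "e ` {u..v} \<subseteq> a" using uv e by auto
    then have "(f ^^ 1) ` (e ` {u..v}) \<subseteq> path_image e'" using e' by auto
    then have "C * lam ^ 1 * d (e u) (e v) \<le> d ((f ^^ 1) (e u)) ((f ^^ 1) (e v))"
      using uv e e'(1) by (intro d(4)[rule_format]) auto
    also have "\<dots> = 0" using uv d(1) sp map_space by auto
    finally have "C * lam * d (e u) (e v) \<le> 0" by simp
    moreover have "0 < d (e u) (e v)" using d(1) sp ne by (simp add: less_le)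
    ultimately show False
      using d(2,3) by (smt (verit) mult_pos_pos)
  qed
  obtain u v where "u \<in> {s..t}" "v \<in> {s..t}" "x = e u" "y = e v" using xy e by auto
  then show "x = y" using *[of u v] *[of v u] xy by (metis linear)
qed

text \<open>The complement of the compact image is open, and no positive iterate can return to it,
  contrary to nonwandering.\<close>

lemma surj_space: "f ` space_of G = space_of G"
proof (rule ccontr)
  assume "f ` space_of G \<noteq> space_of G"
  then obtain x where x: "x \<in> space_of G" "x \<notin> f ` space_of G" using map_space by blast
  define U where "U = space_of G - f ` space_of G"
  have "closed (f ` space_of G)"
    using compact_continuous_image[OF cont compact_space] compact_imp_closed by blast
  then have "openin (top_of_set (space_of G)) U"
    unfolding U_def Diff_eq by (intro openin_open_Int) auto
  moreover have "nonwandering G f"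
    using sys unfolding expanding_graph_system_def by (elim conjE)
  moreover have "x \<in> U" using x by (simp add: U_def)
  ultimately obtain n where n: "n > 0" "(f ^^ n) ` U \<inter> U \<noteq> {}"
    using x(1) unfolding nonwandering_def by meson
  then obtain y where y: "y \<in> space_of G" "(f ^^ n) y \<in> U" by (auto simp: U_def)
  obtain k where "n = Suc k" using n by (cases n) auto
  then have "(f ^^ n) y \<in> f ` space_of G" using iter_space[OF y(1), of k] by auto
  then show False using y by (auto simp: U_def)
qed

section \<open>Exclusion of loops\<close>

text \<open>A preimage of the midpoint of \<open>e\<close> is not a vertex by the Markov property,
  so some letter contains it. The image of this letter is an edge through the midpoint, hence
  \<open>e\<close>.\<close>

lemma edge_is_letter_image:
  assumes "e \<in> edges G" shows "\<exists>a\<in>A. f ` a = path_image e"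
proof -
  have p: "e (1/2) \<in> path_image e - verts G"
    unfolding edge_minus_verts[OF assms] by auto
  then obtain x where x: "x \<in> space_of G" "f x = e (1/2)"
    using surj_space edge_subset[OF assms] by (metis DiffD1 image_iff subsetD)
  then have "x \<notin> verts G" using map_verts p by force
  then obtain a where a: "a \<in> A" "x \<in> a" using letters_cover x by blast
  then obtain e' where e': "e' \<in> edges G" "f ` a = path_image e'" using letter_image by blast
  have "e' = e"
    using edge_unique[OF e'(1) assms, of "e (1/2)"] a x e' p by force
  then show ?thesis using a e' by blast
qed

lemma compose_cont:
  assumes "e \<in> edges G" "0 \<le> s" "t \<le> 1" shows "continuous_on {s..t} (\<lambda>u. f (e u))"
proof (rule continuous_on_compose2[OF cont])
  have st: "{s..t} \<subseteq> {0..1}" using assms by auto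
  then show "continuous_on {s..t} e" by (rule continuous_on_subset[OF edge_cont[OF assms(1)]])
  show "e ` {s..t} \<subseteq> space_of G"
    using edge_subset[OF assms(1)] image_mono[OF st, of e] unfolding path_image_def by (rule order_trans[rotated])
qed

text \<open>An arc cannot be mapped homeomorphically onto a loop, so the preimage letter is a whole edge.\<close>

lemma loop_preimage:
  assumes "e \<in> edges G" "e 0 = e 1"
  shows "\<exists>e'\<in>edges G. e' 0 = e' 1 \<and> f ` path_image e' = path_image e"
proof -
  obtain a where a: "a \<in> A" "f ` a = path_image e" using edge_is_letter_image assms by blast
  obtain e' s t where e': "e' \<in> edges G" "0 \<le> s" "s < t" "t \<le> 1" "a = e' ` {s..t}"
    using a(1) by (elim letterE)
  have "\<not> inj_on e' {s..t}"
  proof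
    assume "inj_on e' {s..t}"
    then have "inj_on (\<lambda>u. f (e' u)) {s..t}"
      using letter_inj[OF a(1)] e' comp_inj_on[of e' "{s..t}" f] by (simp add: o_def)
    moreover have "(\<lambda>u. f (e' u)) ` {s..t} = path_image e" using a e' by auto
    ultimately show False
      using arc_image_not_loop[OF e'(3) compose_cont] e' assms edge_simple by blast
  qed
  \<comment> \<open>A simple path repeats a value only at the parameters 0 and 1.\<close>
  then have "s = 0 \<and> t = 1 \<and> e' 0 = e' 1"
    using edge_simple[OF e'(1)] e'(2-4) unfolding simple_path_def loop_free_def inj_on_def
    by (smt (verit) atLeastAtMost_iff)
  then show ?thesis using a e' by (auto simp: path_image_def)
qed

lemma loop_iterated_preimage:
  assumes "e \<in> edges G" "e 0 = e 1"
  shows "\<exists>e'\<in>edges G. e' 0 = e' 1 \<and> (f ^^ n) ` path_image e' = path_image e"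
  using assms
proof (induction n arbitrary: e)
  case (Suc n)
  obtain e1 where e1: "e1 \<in> edges G" "e1 0 = e1 1" "f ` path_image e1 = path_image e"
    using loop_preimage[OF Suc.prems] by blast
  obtain e2 where e2: "e2 \<in> edges G" "e2 0 = e2 1" "(f ^^ n) ` path_image e2 = path_image e1"
    using Suc.IH[OF e1(1,2)] by blast
  have "(f ^^ Suc n) ` path_image e2 = path_image e"
    unfolding funpow.simps image_comp[symmetric] using e1 e2 by simp
  then show ?case using e2 by blast
qed auto

text \<open>An \<open>n\<close>-th preimage loop exists for every \<open>n\<close>, but there are
  finitely many edges, so these loops have a minimal size. Its expansion exceeds the bound
  \<open>B\<close>.\<close>

lemma no_loops:
  assumes e: "e \<in> edges G" shows "e 0 \<noteq> e 1"
proof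
  assume loop: "e 0 = e 1"
  obtain d C lam B where d:
    "\<forall>x\<in>space_of G. \<forall>y\<in>space_of G. (d x y = 0 \<longleftrightarrow> x = y) \<and> 0 \<le> d x y \<and> d x y \<le> B"
    "C > 0" "lam > (1::real)"
    "\<forall>n e e' s t. n > 0 \<and> e \<in> edges G \<and> e' \<in> edges G \<and> 0 \<le> s \<and> s \<le> t \<and> t \<le> 1 \<and>
       (f ^^ n) ` (e ` {s..t}) \<subseteq> path_image e' \<longrightarrow>
       C * lam ^ n * d (e s) (e t) \<le> d ((f ^^ n) (e s)) ((f ^^ n) (e t))"
    by (rule expansion_bounded)
  \<comment> \<open>The size of an edge is measured on its first half, since the two ends of a loop
    are at distance zero.\<close>
  define D where "D = (\<lambda>e. d (e 0) (e (1/2))) ` edges G"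
  have pt: "e u \<in> space_of G" if "e \<in> edges G" "0 \<le> u" "u \<le> 1" for e u
    using edge_subset[OF that(1)] that by (auto simp: path_image_def)
  have Dfin: "finite D" "D \<noteq> {}" using finite_edges e by (auto simp: D_def)
  have Dpos: "0 < x" if x: "x \<in> D" for x
  proof -
    obtain e where "e \<in> edges G" "x = d (e 0) (e (1/2))" using x by (auto simp: D_def)
    moreover have "e 0 \<noteq> e (1/2)"
      using edge_simple[OF \<open>e \<in> edges G\<close>, unfolded simple_path_def loop_free_def,
          THEN conjunct2, rule_format, of 0 "1/2"] by auto
    ultimately show ?thesis using d(1) pt by (simp add: less_le)
  qed
  have del: "0 < Min D" using Dpos Min_in[OF Dfin] by blast
  have "C * lam ^ n * Min D \<le> B" if n: "n > 0" for n
  proof -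
    obtain e' where e': "e' \<in> edges G" "(f ^^ n) ` path_image e' = path_image e"
      using loop_iterated_preimage[OF e loop] by blast
    have "e' ` {0..1/2} \<subseteq> path_image e'"
      unfolding path_image_def by (intro image_mono) auto
    then have "(f ^^ n) ` (e' ` {0..1/2}) \<subseteq> path_image e"
      unfolding e'(2)[symmetric] by (rule image_mono)
    then have "C * lam ^ n * d (e' 0) (e' (1/2)) \<le> d ((f ^^ n) (e' 0)) ((f ^^ n) (e' (1/2)))"
      using n e'(1) e by (intro d(4)[rule_format]) auto
    also have "\<dots> \<le> B" using d(1) iter_space pt e' by auto
    finally have "C * lam ^ n * d (e' 0) (e' (1/2)) \<le> B" .
    moreover have "Min D \<le> d (e' 0) (e' (1/2))"
      using Min_le[OF Dfin(1)] e' by (auto simp: D_def)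
    moreover have "0 < C * lam ^ n" using d(2,3) by simp
    ultimately show ?thesis by (smt (verit) mult_left_mono)
  qed
  moreover obtain n where "B / (C * Min D) < lam ^ n"
    using real_arch_pow d(3) by blast
  then have "B < C * lam ^ n * Min D"
    using d(2) del by (simp add: field_simps)
  \<comment> \<open>The exponent found may be 0, while the bound needs a positive one, so the
    estimate is passed on to \<open>Suc n\<close>.\<close>
  moreover have "C * lam ^ n * Min D \<le> C * lam ^ Suc n * Min D"
    using d(2,3) del by (intro mult_right_mono mult_left_mono) auto
  ultimately show False by (metis leD le_less_trans less_le_trans zero_less_Suc)
qed

section \<open>Intersections of letters\<close>

lemma edge_inj: assumes "e \<in> edges G" shows "inj_on e {0..1}"
  using edge_simple[OF assms] no_loops[OF assms]
  unfolding simple_path_def loop_free_def inj_on_def by metis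

text \<open>On a letter \<open>f\<close> is a homeomorphism between arcs, and these match end points
  with end points.\<close>

lemma division_point_to_vertex:
  assumes "e \<in> edges G" "0 \<le> s" "s < t" "t \<le> 1" "e ` {s..t} \<in> A" "u = s \<or> u = t"
  shows "f (e u) \<in> verts G"
proof -
  obtain e' where e': "e' \<in> edges G" "f ` (e ` {s..t}) = path_image e'"
    using letter_image[OF assms(5)] by blast
  have "inj_on e {s..t}" using edge_inj[OF assms(1)] assms by (auto intro: inj_on_subset)
  then have "inj_on (\<lambda>u. f (e u)) {s..t}"
    using letter_inj[OF assms(5)] comp_inj_on[of e "{s..t}" f] by (simp add: o_def)
  moreover have "(\<lambda>u. f (e u)) ` {s..t} = path_image e'" using e' by auto
  ultimately have "f (e u) \<in> {e' 0, e' 1}"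
    using arc_image_endpoint[OF assms(3) compose_cont _ edge_path edge_inj] e' assms by blast
  then show ?thesis using edge_ends[OF e'(1)] by auto
qed

text \<open>Off the vertices both letters lie on the same edge. Edges being injective, the common
  point has one parameter, which must be a cut point.\<close>

lemma letters_meet_in_division_points:
  assumes "a \<in> A" "b \<in> A" "a \<noteq> b" "x \<in> a" "x \<in> b"
  shows "f x \<in> verts G"
proof (cases "x \<in> verts G")
  case True
  then show ?thesis using map_verts by simp
next
  case False
  obtain K T where KT: "\<forall>e\<in>edges G. division e (K e) (T e)"
    "A = (\<Union>e\<in>edges G. (\<lambda>i. e ` {T e i..T e (Suc i)}) ` {..<K e})"
    by (rule letters_partition)
  note bounds = division_bounds[OF KT(1)[rule_format]]
  have sub: "e ` {T e i..T e (Suc i)} \<subseteq> path_image e" if "e \<in> edges G" "i < K e" for e i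
    unfolding path_image_def using bounds[OF that] by (intro image_mono) auto
  \<comment> \<open>The parameter is at most \<open>T e (Suc i)\<close> as a point of piece
    \<open>i\<close> and at least \<open>T e j\<close> as a point of piece \<open>j\<close>, so it
    equals \<open>T e (Suc i)\<close>.\<close>
  have *: "f x \<in> verts G"
    if e: "e \<in> edges G" and ij: "i < j" "j < K e"
      and xi: "x \<in> e ` {T e i..T e (Suc i)}" and xj: "x \<in> e ` {T e j..T e (Suc j)}" for e i j
  proof -
    obtain u v where u: "u \<in> {T e i..T e (Suc i)}" "x = e u"
      and v: "v \<in> {T e j..T e (Suc j)}" "x = e v" using xi xj by auto
    have "u = v"
      using inj_onD[OF edge_inj[OF e], of u v] u v bounds[OF e, of i] bounds[OF e, of j] ij by auto
    moreover have "T e (Suc i) \<le> T e j" using division_mono[OF KT(1)[rule_format, OF e], of "Suc i" j] ij by auto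
    ultimately have "u = T e (Suc i)" using u v by auto
    moreover have "e ` {T e i..T e (Suc i)} \<in> A"
      unfolding KT(2) using ij by (intro UN_I[OF e] imageI) auto
    ultimately show ?thesis
      using division_point_to_vertex[OF e] bounds[OF e, of i] ij u by auto
  qed
  obtain e i where e: "e \<in> edges G" "i < K e" "a = e ` {T e i..T e (Suc i)}"
    using assms(1) unfolding KT(2) by auto
  obtain e' j where e': "e' \<in> edges G" "j < K e'" "b = e' ` {T e' j..T e' (Suc j)}"
    using assms(2) unfolding KT(2) by auto
  have "e = e'"
  proof (rule edge_unique[OF e(1) e'(1) _ _ False])
    show "x \<in> path_image e" using sub[OF e(1,2)] assms(4) e(3) by (auto simp: subset_eq)
    show "x \<in> path_image e'" using sub[OF e'(1,2)] assms(5) e'(3) by (auto simp: subset_eq)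
  qed
  then have ij: "i \<noteq> j" using assms(3) e(3) e'(3) by auto
  have xs: "x \<in> e ` {T e i..T e (Suc i)}" "x \<in> e ` {T e j..T e (Suc j)}" "j < K e"
    using assms(4,5) e(3) e' \<open>e = e'\<close> by simp_all
  show ?thesis
  proof (cases "i < j")
    case True
    show ?thesis by (rule *[OF e(1) True xs(3) xs(1,2)])
  next
    case False
    then have "j < i" using ij by simp
    then show ?thesis by (rule *[OF e(1) _ e(2) xs(2,1)])
  qed
qed

text \<open>The map \<open>f\<close> embeds the intersection into the finite vertex set.
  Contrapositively, infinitely many common points identify two letters, which is how letters are
  recognised below.\<close>

lemma letters_meet_finite:
  assumes "a \<in> A" "b \<in> A" "a \<noteq> b"
  shows "finite (a \<inter> b)"
proof (rule inj_on_finite)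
  show "inj_on f (a \<inter> b)" using letter_inj[OF assms(1)] by (auto intro: inj_on_subset)
  show "f ` (a \<inter> b) \<subseteq> verts G" using letters_meet_in_division_points assms by blast
qed (rule finite_verts)

end

section \<open>Itineraries and the cover map\<close>

text \<open>The bound is inclusive: \<open>n + 1\<close> letters are prescribed, and it is the
  iterate \<open>f ^^ Suc n\<close> that maps onto an edge.\<close>

definition itinerary :: "('a \<Rightarrow> 'a) \<Rightarrow> (nat \<Rightarrow> 'a set) \<Rightarrow> nat \<Rightarrow> 'a set" where
  "itinerary f w n = {x. \<forall>j\<le>n. (f ^^ j) x \<in> w j}"

lemma itinerary_0: "itinerary f w 0 = w 0"
  by (simp add: itinerary_def)

lemma itinerary_Suc:
  "itinerary f w (Suc n) = {x \<in> itinerary f w n. (f ^^ Suc n) x \<in> w (Suc n)}"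
  unfolding itinerary_def le_Suc_eq by blast

lemma itinerary_subset: "itinerary f w n \<subseteq> w 0"
  by (auto simp: itinerary_def dest: spec[of _ 0])

lemma inv_limit_map_Suc: "inv_limit_map f x (Suc i) = x i"
  by (simp add: inv_limit_map_def)

lemma inv_limit_iterate: "x \<in> inv_limit G f \<Longrightarrow> (f ^^ j) (x (j + i)) = x i"
proof (induction j arbitrary: i)
  case (Suc j)
  have "(f ^^ Suc j) (x (Suc j + i)) = f ((f ^^ j) (x (j + Suc i)))" by simp
  also have "\<dots> = f (x (Suc i))" using Suc by presburger
  also have "\<dots> = x i" using Suc.prems by (simp add: inv_limit_def)
  finally show ?case .
qed simp

lemma funpow_inv_limit_map: "(inv_limit_map f ^^ n) x 0 = (f ^^ n) (x 0)"
  by (induction n) (auto simp: inv_limit_map_def)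

context graph_cover
begin

section \<open>Finite itineraries as arcs\<close>

text \<open>Words are one-sided here, so that the results apply to a two-sided word read from any
  position.\<close>

definition admissible :: "(nat \<Rightarrow> 'a set) \<Rightarrow> bool" where
  "admissible w \<longleftrightarrow> (\<forall>j. w j \<in> A \<and> w (Suc j) \<subseteq> f ` w j)"

lemma sft_admissible:
  assumes "w \<in> sft f A" shows "admissible (\<lambda>j. w (k + int j))"
  unfolding admissible_def
proof
  fix j
  have "w (k + int j) \<in> A \<and> w (k + int j + 1) \<subseteq> f ` w (k + int j)"
    using assms by (simp add: sft_def)
  moreover have "k + int (Suc j) = k + int j + 1" by simp
  ultimately show "w (k + int j) \<in> A \<and> w (k + int (Suc j)) \<subseteq> f ` w (k + int j)" by metis
qed

lemma itinerary_space: "admissible w \<Longrightarrow> itinerary f w n \<subseteq> space_of G"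
  using itinerary_subset[of f w n] letter_subset[of "w 0"] by (auto simp: admissible_def)

lemma itinerary_compact:
  assumes "admissible w" shows "compact (itinerary f w n)"
proof (induction n)
  case 0
  then show ?case using assms letter_compact by (simp add: itinerary_0 admissible_def)
next
  case (Suc n)
  have "continuous_on (itinerary f w n) (f ^^ Suc n)"
    using continuous_on_subset[OF iter_cont itinerary_space[OF assms]] .
  moreover have "closed (w (Suc n))" using assms letter_closed by (simp add: admissible_def)
  ultimately have "closed (itinerary f w n \<inter> (f ^^ Suc n) -` w (Suc n))"
    using continuous_closed_preimage compact_imp_closed[OF Suc] by blast
  then have "compact (itinerary f w n \<inter> (itinerary f w n \<inter> (f ^^ Suc n) -` w (Suc n)))"
    using Suc compact_Int_closed by blast
  moreover have "itinerary f w (Suc n) = itinerary f w n \<inter> (itinerary f w n \<inter> (f ^^ Suc n) -` w (Suc n))"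
    unfolding itinerary_Suc by blast
  ultimately show ?case by simp
qed

text \<open>By the transition rule each point of \<open>w (Suc n)\<close> has a preimage in
  \<open>w n\<close>, which the induction hypothesis lifts to the itinerary set.\<close>

lemma itinerary_image:
  assumes "admissible w" shows "(f ^^ n) ` itinerary f w n = w n"
proof (induction n)
  case (Suc n)
  show ?case
  proof (intro equalityI subsetI)
    fix y assume y: "y \<in> w (Suc n)"
    then have "y \<in> f ` w n" using assms unfolding admissible_def by blast
    then obtain x where x: "x \<in> itinerary f w n" "y = (f ^^ Suc n) x"
      unfolding Suc[symmetric] by auto
    then have "x \<in> itinerary f w (Suc n)" using y by (simp only: itinerary_Suc mem_Collect_eq)
    then show "y \<in> (f ^^ Suc n) ` itinerary f w (Suc n)" using x(2) by (rule image_eqI[rotated])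
  qed (auto simp: itinerary_Suc)
qed (simp add: itinerary_0)

lemma itinerary_infinite: "admissible w \<Longrightarrow> infinite (itinerary f w n)"
  using itinerary_image[of w n] letter_infinite[of "w n"] finite_imageI[of "itinerary f w n" "f ^^ n"]
  by (auto simp: admissible_def)

text \<open>The iterate \<open>f ^^ j\<close> lands in the letter \<open>w j\<close>, where
  \<open>f\<close> is injective. The last letter \<open>w n\<close> still allows one step, hence the
  bound \<open>Suc n\<close>.\<close>

lemma itinerary_inj:
  assumes "admissible w" "j \<le> Suc n" shows "inj_on (f ^^ j) (itinerary f w n)"
  using assms(2)
proof (induction j)
  case (Suc j)
  have "(f ^^ j) ` itinerary f w n \<subseteq> w j" using Suc.prems by (auto simp: itinerary_def)
  moreover have "inj_on f (w j)" using assms(1) letter_inj by (simp add: admissible_def)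
  ultimately have "inj_on f ((f ^^ j) ` itinerary f w n)" by (rule inj_on_subset[rotated])
  then have "inj_on (f \<circ> f ^^ j) (itinerary f w n)"
    using Suc by (intro comp_inj_on) auto
  then show ?case by (simp only: funpow.simps)
qed simp

lemma itinerary_edge:
  assumes "admissible w"
  obtains e where "e \<in> edges G" "(f ^^ Suc n) ` itinerary f w n = path_image e"
proof -
  have "w n \<in> A" using assms by (simp add: admissible_def)
  then obtain e where "e \<in> edges G" "f ` w n = path_image e" using letter_image by blast
  moreover have "(f ^^ Suc n) ` itinerary f w n = f ` w n"
    unfolding funpow.simps image_comp[symmetric] itinerary_image[OF assms] ..
  ultimately show thesis using that by simp
qed

lemma itinerary_preimage_connected:
  assumes "admissible w" "connected C" "C \<subseteq> (f ^^ Suc n) ` itinerary f w n"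
  shows "connected {x \<in> itinerary f w n. (f ^^ Suc n) x \<in> C}"
  using itinerary_compact[OF assms(1)] itinerary_inj[OF assms(1) order_refl] assms(2,3)
  by (intro connected_preimage_of_compact_inj continuous_on_subset[OF iter_cont itinerary_space[OF assms(1)]])

lemma itinerary_connected:
  assumes "admissible w" shows "connected (itinerary f w n)"
proof -
  obtain e where e: "e \<in> edges G" "(f ^^ Suc n) ` itinerary f w n = path_image e"
    using itinerary_edge[OF assms] .
  then have "connected {x \<in> itinerary f w n. (f ^^ Suc n) x \<in> path_image e}"
    using edge_path by (intro itinerary_preimage_connected[OF assms]) auto
  moreover have "{x \<in> itinerary f w n. (f ^^ Suc n) x \<in> path_image e} = itinerary f w n"
    using e by blast
  ultimately show ?thesis by simp
qed

text \<open>Inside the image edge, the points off the vertices form the connected image of an open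
  interval, and the iterate has a continuous inverse on that edge.\<close>

lemma itinerary_interior_connected:
  assumes "admissible w"
  shows "connected {x \<in> itinerary f w n. (f ^^ Suc n) x \<notin> verts G}"
proof -
  obtain e where e: "e \<in> edges G" "(f ^^ Suc n) ` itinerary f w n = path_image e"
    using itinerary_edge[OF assms] .
  have "connected (e ` {0<..<1})"
    by (intro connected_continuous_image continuous_on_subset[OF edge_cont[OF e(1)]]) auto
  moreover have "e ` {0<..<1} \<subseteq> path_image e" unfolding path_image_def by (intro image_mono) auto
  ultimately have "connected {x \<in> itinerary f w n. (f ^^ Suc n) x \<in> e ` {0<..<1}}"
    unfolding e(2)[symmetric] by (rule itinerary_preimage_connected[OF assms])
  moreover have "{x \<in> itinerary f w n. (f ^^ Suc n) x \<in> e ` {0<..<1}} =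
      {x \<in> itinerary f w n. (f ^^ Suc n) x \<notin> verts G}"
    unfolding edge_minus_verts[OF e(1), symmetric] using e(2) by blast
  ultimately show ?thesis by simp
qed

lemma itinerary_boundary_finite:
  assumes "admissible w"
  shows "finite {x \<in> itinerary f w n. (f ^^ Suc n) x \<in> verts G}"
proof (rule inj_on_finite)
  show "inj_on (f ^^ Suc n) {x \<in> itinerary f w n. (f ^^ Suc n) x \<in> verts G}"
    using itinerary_inj[OF assms order_refl] by (rule inj_on_subset) auto
  show "(f ^^ Suc n) ` {x \<in> itinerary f w n. (f ^^ Suc n) x \<in> verts G} \<subseteq> verts G" by blast
qed (rule finite_verts)

section \<open>Points of infinite itineraries\<close>

text \<open>The interval between the two points stays inside every finite itinerary set, so all
  iterates map it into an edge. Expansion would then make distances unbounded.\<close>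

lemma itinerary_point_unique:
  assumes w: "admissible w" and x: "\<And>j. (f ^^ j) x \<in> w j" and y: "\<And>j. (f ^^ j) y \<in> w j"
  shows "x = y"
proof -
  have "w 0 \<in> A" using w by (simp add: admissible_def)
  then obtain e where e: "e \<in> edges G" "w 0 \<subseteq> path_image e" using letter_in_edge by blast
  obtain u v where u: "0 \<le> u" "u \<le> 1" "x = e u" and v: "0 \<le> v" "v \<le> 1" "y = e v"
    using subsetD[OF e(2), of x] subsetD[OF e(2), of y] x[of 0] y[of 0] by (auto simp: path_image_def)
  obtain d C lam B where d:
    "\<forall>x\<in>space_of G. \<forall>y\<in>space_of G. (d x y = 0 \<longleftrightarrow> x = y) \<and> 0 \<le> d x y \<and> d x y \<le> B"
    "C > 0" "lam > (1::real)"
    "\<forall>n e e' s t. n > 0 \<and> e \<in> edges G \<and> e' \<in> edges G \<and> 0 \<le> s \<and> s \<le> t \<and> t \<le> 1 \<and>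
       (f ^^ n) ` (e ` {s..t}) \<subseteq> path_image e' \<longrightarrow>
       C * lam ^ n * d (e s) (e t) \<le> d ((f ^^ n) (e s)) ((f ^^ n) (e t))"
    by (rule expansion_bounded)
  have *: "e a = e b"
    if ab: "0 \<le> a" "a \<le> b" "b \<le> 1" and J: "\<And>j. (f ^^ j) (e a) \<in> w j" "\<And>j. (f ^^ j) (e b) \<in> w j" for a b
  proof (rule ccontr)
    assume ne: "e a \<noteq> e b"
    have sp: "e a \<in> space_of G" "e b \<in> space_of G"
      using J[of 0] subsetD[OF order_trans[OF e(2) edge_subset[OF e(1)]]] by auto
    have bound: "C * lam ^ Suc n * d (e a) (e b) \<le> B" for n
    proof -
      obtain e' where e': "e' \<in> edges G" "(f ^^ Suc n) ` itinerary f w n = path_image e'"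
        using itinerary_edge[OF w] .
      have "itinerary f w n \<subseteq> e ` {0..1}"
        using itinerary_subset[of f w n] e(2) unfolding path_image_def by (rule order_trans)
      \<comment> \<open>Connectedness is moved to the parameters of \<open>e\<close>, where a
        connected set contains the whole interval between two of its points.\<close>
      then have con: "connected {q \<in> {0..1}. e q \<in> itinerary f w n}"
        using edge_cont[OF e(1)] edge_inj[OF e(1)] itinerary_connected[OF w]
        by (intro connected_preimage_of_compact_inj) auto
      have "c \<in> {q \<in> {0..1}. e q \<in> itinerary f w n}" if "c \<in> {a..b}" for c
        by (rule real_connected_betweenI[OF con, of a b]) (use ab J that in \<open>auto simp: itinerary_def\<close>)
      then have "e ` {a..b} \<subseteq> itinerary f w n" by (simp add: image_subset_iff)
      then have "(f ^^ Suc n) ` (e ` {a..b}) \<subseteq> path_image e'"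
        unfolding e'(2)[symmetric] by (rule image_mono)
      then have "C * lam ^ Suc n * d (e a) (e b) \<le> d ((f ^^ Suc n) (e a)) ((f ^^ Suc n) (e b))"
        using ab e(1) e'(1) by (intro d(4)[rule_format]) auto
      also have "\<dots> \<le> B" using d(1) iter_space[OF sp(1)] iter_space[OF sp(2)] by blast
      finally show ?thesis .
    qed
    have pos: "0 < d (e a) (e b)" using d(1) sp ne by (simp add: less_le)
    obtain n where "B / (C * d (e a) (e b)) < lam ^ n"
      using real_arch_pow d(3) by blast
    then have "B < C * lam ^ n * d (e a) (e b)"
      using d(2) pos by (simp add: field_simps)
    also have "\<dots> \<le> C * lam ^ Suc n * d (e a) (e b)"
      using d(2,3) pos by (intro mult_right_mono mult_left_mono) auto
    finally show False using bound[of n] by simp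
  qed
  show ?thesis
    using *[of u v] *[of v u] u v x y by (cases u v rule: le_cases) simp_all
qed

text \<open>The finite itinerary sets are nested, nonempty and compact.\<close>

lemma itinerary_point_exists:
  assumes w: "admissible w" shows "\<exists>x. \<forall>j. (f ^^ j) x \<in> w j"
proof -
  have mono: "itinerary f w k \<subseteq> itinerary f w n" if "n \<le> k" for n k
    using that by (auto simp: itinerary_def)
  have "space_of G \<inter> (\<Inter>n\<in>UNIV. itinerary f w n) \<noteq> {}"
  proof (rule compact_imp_fip_image[OF compact_space])
    fix I :: "nat set" assume I: "finite I"
    \<comment> \<open>Inserting 0 gives a maximum also for empty \<open>I\<close>.\<close>
    have "itinerary f w (Max (insert 0 I)) \<subseteq> space_of G \<inter> (\<Inter>n\<in>I. itinerary f w n)"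
      using I itinerary_space[OF w] by (intro Int_greatest INT_greatest mono) auto
    moreover have "itinerary f w (Max (insert 0 I)) \<noteq> {}"
      using itinerary_infinite[OF w] by (metis finite.emptyI)
    ultimately show "space_of G \<inter> (\<Inter>n\<in>I. itinerary f w n) \<noteq> {}" by blast
  qed (use itinerary_compact[OF w] compact_imp_closed in auto)
  then show ?thesis by (auto simp: itinerary_def)
qed

definition itinerary_point :: "(nat \<Rightarrow> 'a set) \<Rightarrow> 'a" where
  "itinerary_point w = (THE x. \<forall>j. (f ^^ j) x \<in> w j)"

lemma itinerary_point_eq:
  assumes "admissible w" "\<And>j. (f ^^ j) x \<in> w j" shows "itinerary_point w = x"
  unfolding itinerary_point_def using assms itinerary_point_unique by (intro the_equality) auto

lemma itinerary_point_in:
  assumes "admissible w" shows "(f ^^ j) (itinerary_point w) \<in> w j"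
  using itinerary_point_exists[OF assms] itinerary_point_eq[OF assms] by metis

section \<open>Coordinates of the cover map\<close>

lemma inv_limit_tail: "x \<in> inv_limit G f \<Longrightarrow> (\<lambda>i. x (n + i)) \<in> inv_limit G f"
  by (simp add: inv_limit_def)

lemma inv_limit_map_inverse:
  assumes "x \<in> inv_limit G f"
  shows "inv_into (inv_limit G f) (inv_limit_map f) x = (\<lambda>i. x (Suc i))"
proof (rule inv_into_f_eq)
  show "inj_on (inv_limit_map f) (inv_limit G f)"
    by (rule inj_onI, rule ext) (metis inv_limit_map_Suc)
  show "(\<lambda>i. x (Suc i)) \<in> inv_limit G f" using inv_limit_tail[OF assms, of 1] by simp
  show "inv_limit_map f (\<lambda>i. x (Suc i)) = x"
    using assms by (auto simp: inv_limit_map_def inv_limit_def split: nat.split)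
qed

lemma funpow_inv_limit_map_inverse:
  assumes "x \<in> inv_limit G f"
  shows "(inv_into (inv_limit G f) (inv_limit_map f) ^^ n) x = (\<lambda>i. x (n + i))"
proof (induction n)
  case (Suc n)
  then show ?case
    using inv_limit_map_inverse[OF inv_limit_tail[OF assms, of n]] by simp
qed simp

lemma inv_limit_iter_0:
  assumes "x \<in> inv_limit G f"
  shows "inv_limit_iter G f k x 0 = (if k \<ge> 0 then (f ^^ nat k) (x 0) else x (nat (- k)))"
  using funpow_inv_limit_map_inverse[OF assms]
  by (simp add: inv_limit_iter_def funpow_inv_limit_map)

lemma cylinder_closedin:
  assumes "w \<in> sft f A"
  shows "closedin (top_of_set (inv_limit G f)) (cylinder G f w k)"
proof -
  have "continuous_on (inv_limit G f) (\<lambda>x. if k \<ge> 0 then (f ^^ nat k) (x 0) else x (nat (- k)))"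
  proof (cases "k \<ge> 0")
    case True
    have "continuous_on (inv_limit G f) (\<lambda>x. (f ^^ nat k) (x 0))"
      by (rule continuous_on_compose2[OF iter_cont])
        (auto simp: inv_limit_def intro: continuous_on_subset[OF continuous_on_product_coordinates])
    then show ?thesis using True by simp
  next
    case False
    then show ?thesis
      by (auto intro: continuous_on_subset[OF continuous_on_product_coordinates])
  qed
  moreover have "closed (w k)" using assms letter_closed by (simp add: sft_def)
  ultimately have "closedin (top_of_set (inv_limit G f))
      (inv_limit G f \<inter> (\<lambda>x. if k \<ge> 0 then (f ^^ nat k) (x 0) else x (nat (- k))) -` w k)"
    by (rule continuous_closedin_preimage)
  moreover have "cylinder G f w k =
      inv_limit G f \<inter> (\<lambda>x. if k \<ge> 0 then (f ^^ nat k) (x 0) else x (nat (- k))) -` w k"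
    unfolding cylinder_def using inv_limit_iter_0 by auto
  ultimately show ?thesis by simp
qed

text \<open>The cylinders are closed already, so the closures change nothing. Spreading the
  conditions over all coordinates determines each \<open>x i\<close> by the one-sided word starting
  at \<open>- i\<close>.\<close>

lemma mem_closed_cylinders:
  assumes w: "w \<in> sft f A"
  shows "x \<in> (\<Inter>j. top_of_set (inv_limit G f) closure_of cylinder G f w j) \<longleftrightarrow>
    x \<in> inv_limit G f \<and> (\<forall>i j. (f ^^ j) (x i) \<in> w (int j - int i))"
proof -
  have "x \<in> (\<Inter>j. top_of_set (inv_limit G f) closure_of cylinder G f w j) \<longleftrightarrow>
      x \<in> inv_limit G f \<and> (\<forall>k. (if k \<ge> 0 then (f ^^ nat k) (x 0) else x (nat (- k))) \<in> w k)"
    unfolding cylinder_closedin[OF w, THEN closure_of_eq[THEN iffD2]]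
    by (cases "x \<in> inv_limit G f") (simp_all add: cylinder_def inv_limit_iter_0)
  also have "\<dots> \<longleftrightarrow> x \<in> inv_limit G f \<and> (\<forall>i j. (f ^^ j) (x i) \<in> w (int j - int i))"
  proof (intro conj_cong refl iffI allI)
    fix i j assume x: "x \<in> inv_limit G f"
      and k: "\<forall>k. (if k \<ge> 0 then (f ^^ nat k) (x 0) else x (nat (- k))) \<in> w k"
    show "(f ^^ j) (x i) \<in> w (int j - int i)"
    proof (cases "j < i")
      case True
      then have "(f ^^ j) (x i) = x (i - j)" using inv_limit_iterate[OF x, of j "i - j"] by simp
      moreover have "nat (- (int j - int i)) = i - j" using True by simp
      ultimately show ?thesis using k[rule_format, of "int j - int i"] True by simp
    next
      case False
      then have "(f ^^ j) (x i) = (f ^^ (j - i)) ((f ^^ i) (x (i + 0)))"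
        by (metis add_0_right comp_apply funpow_add le_add_diff_inverse2 not_less)
      also have "\<dots> = (f ^^ (j - i)) (x 0)" using inv_limit_iterate[OF x, of i 0] by simp
      moreover have "nat (int j - int i) = j - i" by simp
      ultimately show ?thesis using k[rule_format, of "int j - int i"] False by simp
    qed
  next
    fix k assume ij: "\<forall>i j. (f ^^ j) (x i) \<in> w (int j - int i)"
    show "(if k \<ge> 0 then (f ^^ nat k) (x 0) else x (nat (- k))) \<in> w k"
      using ij[rule_format, of "nat k" 0] ij[rule_format, of 0 "nat (- k)"] by auto
  qed
  finally show ?thesis .
qed

lemma itinerary_points_inv_limit:
  assumes w: "w \<in> sft f A"
  shows "(\<lambda>i. itinerary_point (\<lambda>j. w (- int i + int j))) \<in> inv_limit G f"
proof -
  let ?p = "\<lambda>i. itinerary_point (\<lambda>j. w (- int i + int j))"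
  note adm = sft_admissible[OF w]
  have "f (?p (Suc i)) = ?p i" for i
  proof (rule itinerary_point_eq[OF adm, symmetric])
    fix j
    have "(f ^^ Suc j) (?p (Suc i)) \<in> w (- int (Suc i) + int (Suc j))"
      by (rule itinerary_point_in[OF adm])
    then show "(f ^^ j) (f (?p (Suc i))) \<in> w (- int i + int j)"
      by (simp add: funpow_swap1)
  qed
  moreover have "?p i \<in> space_of G" for i
    using itinerary_point_in[OF adm, of 0 "- int i"] w letter_subset by (auto simp: sft_def)
  ultimately show ?thesis unfolding inv_limit_def by blast
qed

lemma cover_map_eq:
  assumes w: "w \<in> sft f A"
  shows "cover_map G f w = (\<lambda>i. itinerary_point (\<lambda>j. w (- int i + int j)))"
  unfolding cover_map_def mem_closed_cylinders[OF w]
proof (rule the_equality)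
  let ?p = "\<lambda>i. itinerary_point (\<lambda>j. w (- int i + int j))"
  have "(f ^^ j) (?p i) \<in> w (int j - int i)" for i j
    using itinerary_point_in[OF sft_admissible[OF w], of j "- int i"] by (simp add: algebra_simps)
  then show "?p \<in> inv_limit G f \<and> (\<forall>i j. (f ^^ j) (?p i) \<in> w (int j - int i))"
    using itinerary_points_inv_limit[OF w] by simp
next
  fix x assume x: "x \<in> inv_limit G f \<and> (\<forall>i j. (f ^^ j) (x i) \<in> w (int j - int i))"
  show "x = (\<lambda>i. itinerary_point (\<lambda>j. w (- int i + int j)))"
    using x by (intro ext itinerary_point_eq[OF sft_admissible[OF w], symmetric]) (simp add: algebra_simps)
qed

lemma cover_map_inv_limit: "w \<in> sft f A \<Longrightarrow> cover_map G f w \<in> inv_limit G f"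
  using itinerary_points_inv_limit by (simp add: cover_map_eq)

lemma cover_map_in: "w \<in> sft f A \<Longrightarrow> (f ^^ j) (cover_map G f w i) \<in> w (int j - int i)"
  using itinerary_point_in[OF sft_admissible, of w j "- int i"]
  by (simp add: cover_map_eq algebra_simps)

lemma cover_mapI:
  assumes "w \<in> sft f A" "\<And>i j. (f ^^ j) (x i) \<in> w (int j - int i)"
  shows "cover_map G f w = x"
  unfolding cover_map_eq[OF assms(1)]
  using assms(2) by (intro ext itinerary_point_eq[OF sft_admissible[OF assms(1)]]) (simp add: algebra_simps)

text \<open>Only the future of \<open>w\<close> is replaced, by letters following the orbit of
  \<open>x\<close>. The block starts at \<open>- n\<close>, so \<open>x\<close> appears as
  coordinate \<open>n\<close> of the covered point.\<close>

lemma sft_extension: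
  assumes w: "w \<in> sft f A" and x: "x \<in> itinerary f (\<lambda>j. w (- int n + int j)) (2 * n)"
  shows "\<exists>v\<in>sft f A. (\<forall>k\<le>int n. v k = w k) \<and> cover_map G f v n = x"
proof -
  \<comment> \<open>The letter \<open>z i\<close> is meant for position \<open>n + i\<close>,
    visited at time \<open>2 * n + i\<close>; fixing \<open>z 0\<close> joins the new future to
    \<open>w\<close>.\<close>
  have "\<exists>z. \<forall>i. (z i \<in> A \<and> (f ^^ (2 * n + i)) x \<in> z i \<and> (i = 0 \<longrightarrow> z i = w (int n))) \<and> z (Suc i) \<subseteq> f ` z i"
  proof (rule dependent_nat_choice)
    have "(f ^^ (2 * n)) x \<in> w (- int n + int (2 * n))" using x by (auto simp: itinerary_def)
    moreover have "- int n + int (2 * n) = int n" by simp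
    ultimately show "\<exists>z. z \<in> A \<and> (f ^^ (2 * n + 0)) x \<in> z \<and> (0 = (0::nat) \<longrightarrow> z = w (int n))"
      using w by (auto simp: sft_def)
  next
    fix z i assume z: "z \<in> A \<and> (f ^^ (2 * n + i)) x \<in> z \<and> (i = 0 \<longrightarrow> z = w (int n))"
    then have "(f ^^ (2 * n + Suc i)) x \<in> f ` z" by simp
    then show "\<exists>z'. (z' \<in> A \<and> (f ^^ (2 * n + Suc i)) x \<in> z' \<and> (Suc i = 0 \<longrightarrow> z' = w (int n))) \<and> z' \<subseteq> f ` z"
      using successor_letter z by blast
  qed
  then obtain z where z: "\<forall>i. (z i \<in> A \<and> (f ^^ (2 * n + i)) x \<in> z i \<and> (i = 0 \<longrightarrow> z i = w (int n))) \<and>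
      z (Suc i) \<subseteq> f ` z i" ..
  then have z: "z i \<in> A" "(f ^^ (2 * n + i)) x \<in> z i" "z 0 = w (int n)" "z (Suc i) \<subseteq> f ` z i" for i
    by simp_all
  define v where "v k = (if k \<le> int n then w k else z (nat (k - int n)))" for k
  have v: "v \<in> sft f A"
    unfolding sft_def
  proof (intro CollectI allI conjI)
    fix k
    show "v k \<in> A" using w z(1) by (auto simp: v_def sft_def)
    show "v (k + 1) \<subseteq> f ` v k"
    proof (cases "k < int n")
      case True
      then show ?thesis using w by (simp add: v_def sft_def)
    next
      case False
      then have "v k = z (nat (k - int n))" using z(3) by (auto simp: v_def)
      moreover have "nat (k + 1 - int n) = Suc (nat (k - int n))" using False by linarith
      then have "v (k + 1) = z (Suc (nat (k - int n)))" using False by (simp add: v_def)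
      ultimately show ?thesis using z(4) by simp
    qed
  qed
  have "cover_map G f v n = x"
    unfolding cover_map_eq[OF v]
  proof (rule itinerary_point_eq[OF sft_admissible[OF v]])
    fix j
    show "(f ^^ j) x \<in> v (- int n + int j)"
    proof (cases "j \<le> 2 * n")
      case True
      then show ?thesis using x by (auto simp: v_def itinerary_def)
    next
      case False
      then obtain i where i: "j = 2 * n + i" "i > 0" by (metis less_imp_add_positive not_less)
      then have "v (- int n + int j) = z i" by (simp add: v_def)
      then show ?thesis using z(2)[of i] i by simp
    qed
  qed
  then show ?thesis using v by (intro bexI[of _ v]) (auto simp: v_def)
qed

end

section \<open>Topology of the subshift\<close>

lemma topspace_sft_topology: "topspace (sft_topology f A) = sft f A"
  by (auto simp: sft_topology_def sft_def)

lemma sft_letter: "w \<in> sft f A \<Longrightarrow> w k \<in> A"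
  by (simp add: sft_def)

lemma shift_sft: "w \<in> sft f A \<Longrightarrow> (\<lambda>k. w (k + n)) \<in> sft f A"
  unfolding sft_def mem_Collect_eq by (metis add.assoc add.commute)

text \<open>Each coordinate is read off finitely many positions, hence is locally constant;
  continuity into the product is coordinatewise.\<close>

lemma continuous_map_sft:
  assumes F: "\<And>w. w \<in> sft f A \<Longrightarrow> F w \<in> sft g B"
    and local: "\<And>k. \<exists>S. finite S \<and> (\<forall>w\<in>sft f A. \<forall>v\<in>sft f A. (\<forall>i\<in>S. v i = w i) \<longrightarrow> F v k = F w k)"
  shows "continuous_map (sft_topology f A) (sft_topology g B) F"
proof -
  have "continuous_map (sft_topology f A) (discrete_topology B) (\<lambda>w. F w k)" for k
    unfolding continuous_map_def
  proof (intro conjI allI impI)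
    show "(\<lambda>w. F w k) \<in> topspace (sft_topology f A) \<rightarrow> topspace (discrete_topology B)"
      using sft_letter[OF F] by (simp add: topspace_sft_topology)
  next
    fix U
    obtain S where S: "finite S"
      "\<forall>w\<in>sft f A. \<forall>v\<in>sft f A. (\<forall>i\<in>S. v i = w i) \<longrightarrow> F v k = F w k"
      using local[of k] by (elim exE conjE)
    let ?Q = "{w \<in> topspace (sft_topology f A). F w k \<in> U}"
    show "openin (sft_topology f A) ?Q"
    proof (subst openin_subopen, intro ballI)
      fix w assume "w \<in> ?Q"
      then have w: "w \<in> sft f A" "F w k \<in> U" by (auto simp: topspace_sft_topology)
      \<comment> \<open>The basic open set of all sequences agreeing with \<open>w\<close> on
        \<open>S\<close>.\<close>
      define N where "N = (\<Pi>\<^sub>E i\<in>UNIV. if i \<in> S then {w i} else A)"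
      have wA: "w i \<in> A" for i using sft_letter[OF w(1)] .
      have "openin (product_topology (\<lambda>_. discrete_topology A) UNIV) N"
        unfolding N_def
      proof (rule product_topology_basis)
        show "finite {i. (if i \<in> S then {w i} else A) \<noteq> topspace (discrete_topology A)}"
          by (rule finite_subset[OF _ S(1)]) auto
      qed (use wA in auto)
      then have "openin (sft_topology f A) (N \<inter> sft f A)"
        unfolding sft_topology_def by (rule openin_subtopology_Int)
      moreover have "w \<in> N \<inter> sft f A" using w wA by (auto simp: N_def)
      moreover have "N \<inter> sft f A \<subseteq> ?Q"
      proof
        fix v assume v: "v \<in> N \<inter> sft f A"
        then have "v i = w i" if "i \<in> S" for i using that by (auto simp: N_def PiE_iff split: if_split_asm)
        then have "F v k = F w k" using S(2)[rule_format, of w v] w v by simp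
        then show "v \<in> ?Q" using v w by (auto simp: topspace_sft_topology)
      qed
      ultimately show "\<exists>T. openin (sft_topology f A) T \<and> w \<in> T \<and> T \<subseteq> ?Q" by blast
    qed
  qed
  then show ?thesis
    unfolding sft_topology_def[of g B] continuous_map_in_subtopology continuous_map_componentwise_UNIV
    using F by (simp add: topspace_sft_topology)
qed

text \<open>A pointwise converse of the preceding lemma: \<open>S\<close> may depend on
  \<open>w\<close>, which is enough for uniqueness of the lift.\<close>

lemma continuous_map_sft_local:
  assumes F: "continuous_map (sft_topology f A) (sft_topology g B) F" and w: "w \<in> sft f A"
  shows "\<exists>S. finite S \<and> (\<forall>v\<in>sft f A. (\<forall>i\<in>S. v i = w i) \<longrightarrow> F v k = F w k)"
proof -
  have Fw: "F w \<in> sft g B"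
    using continuous_map_image_subset_topspace[OF F, unfolded topspace_sft_topology] w by blast
  have "continuous_map (sft_topology f A) (product_topology (\<lambda>_. discrete_topology B) UNIV) F"
    using F unfolding sft_topology_def[of g B] continuous_map_in_subtopology by blast
  then have "continuous_map (sft_topology f A) (discrete_topology B) (\<lambda>w. F w k)"
    unfolding continuous_map_componentwise_UNIV by blast
  moreover have "openin (discrete_topology B) {F w k}" using sft_letter[OF Fw] by simp
  ultimately have "openin (sft_topology f A) {v \<in> topspace (sft_topology f A). F v k \<in> {F w k}}"
    by (rule openin_continuous_map_preimage)
  then obtain T where T: "openin (product_topology (\<lambda>_. discrete_topology A) UNIV) T"
    "{v \<in> sft f A. F v k = F w k} = T \<inter> sft f A"
    unfolding topspace_sft_topology unfolding sft_topology_def openin_subtopology by auto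
  then have "w \<in> T" using w by blast
  from product_topology_open_contains_basis[OF T(1) this] obtain X where
    X: "w \<in> (\<Pi>\<^sub>E i\<in>UNIV. X i)" "finite {i. X i \<noteq> topspace (discrete_topology A)}"
      "(\<Pi>\<^sub>E i\<in>UNIV. X i) \<subseteq> T" by blast
  have "F v k = F w k"
    if v: "v \<in> sft f A" "\<forall>i\<in>{i. X i \<noteq> topspace (discrete_topology A)}. v i = w i" for v
  proof -
    have "v i \<in> X i" for i
    proof (cases "X i = A")
      case True
      then show ?thesis using sft_letter[OF v(1)] by simp
    next
      case False
      then have "v i = w i" using v(2) by simp
      then show ?thesis using X(1) by auto
    qed
    then have "v \<in> T" using X(3) by auto
    then show ?thesis using T(2) v(1) by blast
  qed
  then show ?thesis using X(2) by blast
qed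

section \<open>Block codes induced by a shift equivalence\<close>

text \<open>The window \<open>k - m, ..., k\<close> ends at \<open>k\<close> because coordinate
  \<open>i\<close> of \<open>induced_map m r\<close> reads \<open>x (m + i)\<close>, whose itinerary
  starts at \<open>- int (m + i)\<close>.\<close>

definition block_code ::
    "('a \<Rightarrow> 'a) \<Rightarrow> ('a \<Rightarrow> 'b) \<Rightarrow> 'b set set \<Rightarrow> nat \<Rightarrow> (int \<Rightarrow> 'a set) \<Rightarrow> int \<Rightarrow> 'b set" where
  "block_code f r B m w k = (THE b. b \<in> B \<and> r ` itinerary f (\<lambda>j. w (k - int m + int j)) m \<subseteq> b)"

lemma block_code_shift: "block_code f r B m (\<lambda>i. w (i + n)) k = block_code f r B m w (k + n)"
  by (simp add: block_code_def algebra_simps)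

lemma block_code_local:
  assumes "\<forall>i\<in>{k - int m..k}. v i = w i"
  shows "block_code f r B m v k = block_code f r B m w k"
proof -
  have "itinerary f (\<lambda>j. v (k - int m + int j)) m = itinerary f (\<lambda>j. w (k - int m + int j)) m"
    unfolding itinerary_def using assms by auto
  then show ?thesis by (simp add: block_code_def)
qed

locale cover_pair = X: graph_cover X f A + Y: graph_cover Y g B
  for X :: "'a::t2_space top_graph" and f A and Y :: "'b::t2_space top_graph" and g B +
  fixes r :: "'a \<Rightarrow> 'b" and s :: "'b \<Rightarrow> 'a" and m :: nat
  assumes shift_eq: "shift_equivalent_by X f Y g m r s"
    and graph_map_r: "graph_map X Y r" and graph_map_s: "graph_map Y X s"
begin

lemma r_cont: "continuous_on (space_of X) r" and r_space: "x \<in> space_of X \<Longrightarrow> r x \<in> space_of Y"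
  and s_verts: "y \<in> verts Y \<Longrightarrow> s y \<in> verts X"
  using graph_map_r graph_map_s by (auto simp: graph_map_def continuous_between_def)

lemma r_comm: "x \<in> space_of X \<Longrightarrow> r (f x) = g (r x)"
  and s_comm: "y \<in> space_of Y \<Longrightarrow> s (g y) = f (s y)"
  and s_r: "x \<in> space_of X \<Longrightarrow> s (r x) = (f ^^ m) x"
  and r_s: "y \<in> space_of Y \<Longrightarrow> r (s y) = (g ^^ m) y"
  using shift_eq by (auto simp: shift_equivalent_by_def)

lemma r_iter: "x \<in> space_of X \<Longrightarrow> (g ^^ j) (r x) = r ((f ^^ j) x)"
  by (induction j) (simp_all add: r_comm X.iter_space)

text \<open>By this symmetry every result on \<open>r\<close> holds for \<open>s\<close> too, which
  supplies the inverse maps.\<close>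

lemma swap: "cover_pair Y g B X f A s r m"
proof
  show "shift_equivalent_by Y g X f m s r"
    using shift_eq unfolding shift_equivalent_by_def by auto
qed (rule graph_map_s graph_map_r)+

text \<open>Composing with \<open>s\<close> gives the iterate \<open>f ^^ (m + j)\<close>, injective
  on the arc by \<open>itinerary_inj\<close>.\<close>

lemma r_inj:
  assumes "X.admissible w" "m + j \<le> Suc n" shows "inj_on (\<lambda>x. r ((f ^^ j) x)) (itinerary f w n)"
proof (rule inj_onI)
  fix x y assume xy: "x \<in> itinerary f w n" "y \<in> itinerary f w n" "r ((f ^^ j) x) = r ((f ^^ j) y)"
  have "x \<in> space_of X" "y \<in> space_of X" using xy X.itinerary_space[OF assms(1)] by auto
  then have "(f ^^ (m + j)) x = (f ^^ (m + j)) y"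
    using xy(3) s_r X.iter_space by (metis comp_apply funpow_add)
  then show "x = y" using X.itinerary_inj[OF assms] xy by (auto dest: inj_onD)
qed

text \<open>Both letters contain the injective image of an infinite arc.\<close>

lemma unique_letter:
  assumes "X.admissible w" "m + j \<le> Suc n" "b \<in> B" "b' \<in> B"
    "\<And>x. x \<in> itinerary f w n \<Longrightarrow> r ((f ^^ j) x) \<in> b" "\<And>x. x \<in> itinerary f w n \<Longrightarrow> r ((f ^^ j) x) \<in> b'"
  shows "b = b'"
proof (rule ccontr)
  assume "b \<noteq> b'"
  then have "finite (b \<inter> b')" using Y.letters_meet_finite assms(3,4) by blast
  moreover have "(\<lambda>x. r ((f ^^ j) x)) ` itinerary f w n \<subseteq> b \<inter> b'" using assms(5,6) by blast
  ultimately have "finite (itinerary f w n)"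
    using finite_subset finite_imageD[OF _ r_inj[OF assms(1,2)]] by blast
  then show False using X.itinerary_infinite[OF assms(1)] by blast
qed

text \<open>
  The image of the interior is connected and meets no division point of \<open>Y\<close>, so the finitely many
  letters cut it into disjoint relatively closed pieces.
\<close>

lemma letter_contains_image:
  assumes w: "X.admissible w"
  shows "\<exists>b\<in>B. r ` itinerary f w m \<subseteq> b"
proof -
  let ?J = "itinerary f w m"
  \<comment> \<open>The open arc inside the itinerary arc; only finitely many points are
    dropped.\<close>
  define J where "J = {x \<in> ?J. (f ^^ Suc m) x \<notin> verts X}"
  have JX: "?J \<subseteq> space_of X" using X.itinerary_space[OF w] .
  have "continuous_on J r"
    using JX by (intro continuous_on_subset[OF r_cont]) (auto simp: J_def)
  then have con: "connected (r ` J)"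
    using connected_continuous_image X.itinerary_interior_connected[OF w, of m] unfolding J_def by blast
  have fin: "finite (?J - J)"
    using X.itinerary_boundary_finite[OF w, of m] by (rule finite_subset[rotated]) (auto simp: J_def)
  then have "J \<noteq> {}" using X.itinerary_infinite[OF w, of m] by auto
  \<comment> \<open>Here \<open>s\<close> must preserve vertices: applying it to
    \<open>g (r x)\<close> gives \<open>f ((f ^^ m) x)\<close>, which is off the vertices on
    \<open>J\<close>.\<close>
  have gV: "g y \<notin> verts Y" if y: "y \<in> r ` J" for y
  proof
    assume "g y \<in> verts Y"
    then have "s (g y) \<in> verts X" by (rule s_verts)
    moreover obtain x where x: "x \<in> J" "y = r x" using y by blast
    moreover have "x \<in> space_of X" using x JX by (auto simp: J_def)
    ultimately have "f ((f ^^ m) x) \<in> verts X" by (simp add: s_comm r_space s_r)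
    then show False using x by (simp add: J_def)
  qed
  have cov: "\<exists>b\<in>B. y \<in> b" if y: "y \<in> r ` J" for y
  proof (rule Y.letters_cover)
    show "y \<in> space_of Y" using y JX r_space by (auto simp: J_def)
    show "y \<notin> verts Y" using gV[OF y] Y.map_verts by blast
  qed
  obtain x0 where "x0 \<in> J" using \<open>J \<noteq> {}\<close> by blast
  then obtain b where b: "b \<in> B" "r x0 \<in> b" using cov by blast
  have "b \<inter> \<Union>(B - {b}) \<inter> r ` J = {}"
    using gV Y.letters_meet_in_division_points[OF b(1)] by blast
  moreover have "r ` J \<subseteq> b \<union> \<Union>(B - {b})" using cov by blast
  moreover have "closed b" using Y.letter_closed b(1) .
  moreover have "closed (\<Union>(B - {b}))" using Y.finite_letters Y.letter_closed by (intro closed_Union) auto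
  ultimately have "b \<inter> r ` J = {} \<or> \<Union>(B - {b}) \<inter> r ` J = {}"
    using connected_closedD[OF con] by blast
  then have rJ: "r ` J \<subseteq> b" using b(2) \<open>x0 \<in> J\<close> cov by blast
  \<comment> \<open>Closedness of \<open>b\<close> recovers the finitely many dropped
    points.\<close>
  have "closed (?J \<inter> r -` b)"
    using continuous_closed_preimage[OF continuous_on_subset[OF r_cont JX] _ Y.letter_closed[OF b(1)]]
      compact_imp_closed[OF X.itinerary_compact[OF w]] by blast
  moreover have "?J - (?J - J) \<subseteq> ?J \<inter> r -` b" using rJ by blast
  ultimately have "?J \<subseteq> ?J \<inter> r -` b"
    using connected_closed_cofinite[OF X.itinerary_connected[OF w] X.itinerary_infinite[OF w] fin] by blast
  then show ?thesis using b(1) by blast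
qed

lemma block_code_eq:
  assumes "w \<in> sft f A" "b \<in> B" "r ` itinerary f (\<lambda>j. w (k - int m + int j)) m \<subseteq> b"
  shows "block_code f r B m w k = b"
  unfolding block_code_def
proof (rule the_equality)
  fix b' assume "b' \<in> B \<and> r ` itinerary f (\<lambda>j. w (k - int m + int j)) m \<subseteq> b'"
  then show "b' = b"
    using unique_letter[OF X.sft_admissible[OF assms(1), of "k - int m"], where j=0 and n=m and b=b' and b'=b] assms
    by (auto simp: image_subset_iff)
qed (use assms in auto)

lemma
  assumes "w \<in> sft f A"
  shows block_code_letter: "block_code f r B m w k \<in> B"
    and block_code_image: "\<And>x. x \<in> itinerary f (\<lambda>j. w (k - int m + int j)) m \<Longrightarrow> r x \<in> block_code f r B m w k"
proof -
  obtain b where "b \<in> B" "r ` itinerary f (\<lambda>j. w (k - int m + int j)) m \<subseteq> b"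
    using letter_contains_image X.sft_admissible[OF assms] by blast
  moreover from this have "block_code f r B m w k = b" using block_code_eq assms by blast
  ultimately show "block_code f r B m w k \<in> B"
    "\<And>x. x \<in> itinerary f (\<lambda>j. w (k - int m + int j)) m \<Longrightarrow> r x \<in> block_code f r B m w k" by auto
qed

text \<open>Applying \<open>f ^^ i\<close> to a point of a longer arc slides the window
  \<open>i\<close> places forward.\<close>

lemma block_code_image_iter:
  assumes w: "w \<in> sft f A" and x: "x \<in> itinerary f (\<lambda>j. w (k + int j)) n" and i: "i + m \<le> n"
  shows "r ((f ^^ i) x) \<in> block_code f r B m w (k + int m + int i)"
proof (rule block_code_image[OF w])
  have "(f ^^ j) ((f ^^ i) x) \<in> w (k + int i + int j)" if "j \<le> m" for j
  proof -
    have "(f ^^ (j + i)) x \<in> w (k + int (j + i))"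
      using x[unfolded itinerary_def mem_Collect_eq, rule_format, of "j + i"] i that by simp
    moreover have "k + int (j + i) = k + int i + int j" by simp
    ultimately show ?thesis by (simp only: funpow_add comp_apply)
  qed
  then show "(f ^^ i) x \<in> itinerary f (\<lambda>j. w (k + int m + int i - int m + int j)) m"
    by (simp add: itinerary_def algebra_simps)
qed

text \<open>A transition is certified by one point whose image under \<open>r\<close> visits both
  letters and is off the vertices at the second visit.\<close>

lemma block_code_sft:
  assumes w: "w \<in> sft f A" shows "block_code f r B m w \<in> sft g B"
  unfolding sft_def
proof (intro CollectI allI conjI)
  fix k
  show "block_code f r B m w k \<in> B" by (rule block_code_letter[OF w])
  \<comment> \<open>Two consecutive windows together span \<open>m + 2\<close> letters.\<close>
  let ?J = "itinerary f (\<lambda>j. w (k - int m + int j)) (Suc m)"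
  note adm = X.sft_admissible[OF w, of "k - int m"]
  have "finite (verts Y)" by (rule Y.finite_verts)
  have inj: "inj_on (\<lambda>x. r ((f ^^ 1) x)) ?J" using r_inj[OF adm, of 1 "Suc m"] by simp
  \<comment> \<open>The image of the arc is infinite, the vertex set finite.\<close>
  have "\<not> (\<lambda>x. r ((f ^^ 1) x)) ` ?J \<subseteq> verts Y"
    using X.itinerary_infinite[OF adm] finite_imageD[OF _ inj] finite_subset Y.finite_verts by blast
  then obtain x where x: "x \<in> ?J" "r (f x) \<notin> verts Y" by auto
  have xX: "x \<in> space_of X" using x X.itinerary_space[OF adm] by auto
  have "r x \<in> block_code f r B m w k" "r (f x) \<in> block_code f r B m w (k + 1)"
    using block_code_image_iter[OF w x(1), of 0] block_code_image_iter[OF w x(1), of 1] by auto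
  then show "block_code f r B m w (k + 1) \<subseteq> g ` block_code f r B m w k"
    using r_comm[OF xX] x(2)
    by (intro Y.successor_letter_if_meets[of _ _ "r (f x)"] block_code_letter[OF w]) auto
qed

text \<open>Since \<open>r\<close> intertwines the two maps, the orbit of
  \<open>r (x (m + i))\<close> is followed through the windows along the orbit of
  \<open>x (m + i)\<close>; the delay \<open>m\<close> of the code cancels the offset
  \<open>m\<close>.\<close>

lemma cover_map_block_code:
  assumes w: "w \<in> sft f A"
  shows "cover_map Y g (block_code f r B m w) = induced_map m r (cover_map X f w)"
proof (rule Y.cover_mapI[OF block_code_sft[OF w]])
  fix i j
  let ?x = "cover_map X f w (m + i)"
  have x: "(f ^^ l) ?x \<in> w (int l - int (m + i))" for l using X.cover_map_in[OF w] .
  have "?x \<in> space_of X" using x[of 0] X.letter_subset w by (auto simp: sft_def)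
  moreover have "?x \<in> itinerary f (\<lambda>l. w (- int (m + i) + int l)) (j + m)"
    using x by (simp add: itinerary_def algebra_simps)
  from block_code_image_iter[OF w this, of j]
  have "r ((f ^^ j) ?x) \<in> block_code f r B m w (int j - int i)" by (simp add: algebra_simps)
  ultimately show "(g ^^ j) (induced_map m r (cover_map X f w) i) \<in> block_code f r B m w (int j - int i)"
    by (simp add: induced_map_def r_iter)
qed

section \<open>The lift as a conjugacy\<close>

text \<open>Each code looks back \<open>m\<close> places, so an arc of \<open>2 * m + 1\<close>
  letters is used. On it \<open>(f ^^ m) x = s (r x)\<close> lies in both letters compared, which
  thus share infinitely many points.\<close>

lemma block_code_inverse:
  assumes w: "w \<in> sft f A"
  shows "block_code g s A m (block_code f r B m w) k = w (k - int m)"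
proof -
  interpret S: cover_pair Y g B X f A s r m by (rule swap)
  let ?z = "block_code f r B m w"
  let ?J = "itinerary f (\<lambda>j. w (k - 2 * int m + int j)) (2 * m)"
  note adm = X.sft_admissible[OF w, of "k - 2 * int m"]
  have z: "?z \<in> sft g B" by (rule block_code_sft[OF w])
  have 1: "(f ^^ m) x \<in> block_code g s A m ?z k" if x: "x \<in> ?J" for x
  proof -
    have xX: "x \<in> space_of X" using x X.itinerary_space[OF adm] by auto
    have "(g ^^ i) (r x) \<in> ?z (k - int m + int i)" if "i \<le> m" for i
      using block_code_image_iter[OF w x, of i] that r_iter[OF xX] by (simp add: algebra_simps)
    then have "r x \<in> itinerary g (\<lambda>j. ?z (k - int m + int j)) m" by (simp add: itinerary_def)
    from S.block_code_image[OF z this] show ?thesis using s_r[OF xX] by simp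
  qed
  have 2: "(f ^^ m) x \<in> w (k - int m)" if x: "x \<in> ?J" for x
  proof -
    have "(f ^^ m) x \<in> w (k - 2 * int m + int m)"
      using x[unfolded itinerary_def mem_Collect_eq, rule_format, of m] by simp
    moreover have "k - 2 * int m + int m = k - int m" by simp
    ultimately show ?thesis by metis
  qed
  have "infinite ((f ^^ m) ` ?J)"
    using X.itinerary_infinite[OF adm] finite_imageD[OF _ X.itinerary_inj[OF adm, of m "2 * m"]] by auto
  moreover have "(f ^^ m) ` ?J \<subseteq> block_code g s A m ?z k \<inter> w (k - int m)" using 1 2 by blast
  ultimately have "infinite (block_code g s A m ?z k \<inter> w (k - int m))" using finite_subset by blast
  moreover have "w (k - int m) \<in> A" using w by (simp add: sft_def)
  ultimately show ?thesis
    using X.letters_meet_finite S.block_code_letter[OF z] by blast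
qed

lemma block_code_continuous:
  "continuous_map (sft_topology f A) (sft_topology g B) (\<lambda>w k. block_code f r B m w (k + n))"
proof (rule continuous_map_sft)
  fix w assume "w \<in> sft f A"
  then show "(\<lambda>k. block_code f r B m w (k + n)) \<in> sft g B" by (intro shift_sft block_code_sft)
next
  fix k
  show "\<exists>S. finite S \<and> (\<forall>w\<in>sft f A. \<forall>v\<in>sft f A. (\<forall>i\<in>S. v i = w i) \<longrightarrow>
      block_code f r B m v (k + n) = block_code f r B m w (k + n))"
    by (intro exI[of _ "{k + n - int m..k + n}"] conjI ballI impI block_code_local) simp_all
qed

lemma block_code_homeomorphic:
  "homeomorphic_map (sft_topology f A) (sft_topology g B) (restrict (block_code f r B m) (sft f A))"
proof -
  interpret S: cover_pair Y g B X f A s r m by (rule swap)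
  \<comment> \<open>The shift by \<open>m\<close> undoes the delay of the composed codes.\<close>
  have "homeomorphic_maps (sft_topology f A) (sft_topology g B) (block_code f r B m)
      (\<lambda>z k. block_code g s A m z (k + int m))"
    unfolding homeomorphic_maps_def topspace_sft_topology
  proof (intro conjI ballI)
    show "continuous_map (sft_topology f A) (sft_topology g B) (block_code f r B m)"
      using block_code_continuous[of 0] by simp
    show "continuous_map (sft_topology g B) (sft_topology f A) (\<lambda>z k. block_code g s A m z (k + int m))"
      by (rule S.block_code_continuous)
    show "(\<lambda>k. block_code g s A m (block_code f r B m w) (k + int m)) = w" if "w \<in> sft f A" for w
      using block_code_inverse[OF that] by simp
    show "block_code f r B m (\<lambda>k. block_code g s A m z (k + int m)) = z" if "z \<in> sft g B" for z
      using S.block_code_inverse[OF that] by (intro ext) (simp add: block_code_shift)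
  qed
  then have "homeomorphic_map (sft_topology f A) (sft_topology g B) (block_code f r B m)"
    unfolding homeomorphic_map_maps by blast
  then show ?thesis
    by (rule homeomorphic_map_eq) (simp add: topspace_sft_topology)
qed

lemma block_code_conjugacy:
  "conjugacy (sft_topology f A) shift_map (sft_topology g B) shift_map
     (restrict (block_code f r B m) (sft f A))"
  unfolding conjugacy_def topspace_sft_topology
proof (intro conjI ballI block_code_homeomorphic)
  fix w assume w: "w \<in> sft f A"
  then have "shift_map w \<in> sft f A" unfolding shift_map_def by (rule shift_sft)
  then show "restrict (block_code f r B m) (sft f A) (shift_map w) =
      shift_map (restrict (block_code f r B m) (sft f A) w)"
    using w by (auto simp: shift_map_def block_code_shift)
qed

section \<open>Uniqueness of the lift\<close>

text \<open>
  Coordinate \<open>0\<close> of \<open>h\<close> is constant on a cylinder around \<open>w\<close>, and by \<open>sft_extension\<close> every point of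
  the arc of that cylinder is covered by some word in it.
\<close>

lemma lift_letter:
  assumes h: "continuous_map (sft_topology f A) (sft_topology g B) h"
    and lift: "\<And>w. w \<in> sft f A \<Longrightarrow> cover_map Y g (h w) = induced_map m r (cover_map X f w)"
    and w: "w \<in> sft f A"
  shows "h w 0 = block_code f r B m w 0"
proof -
  have hs: "h v \<in> sft g B" if "v \<in> sft f A" for v
    using continuous_map_image_subset_topspace[OF h, unfolded topspace_sft_topology] that by blast
  obtain S where S: "finite S" "\<forall>v\<in>sft f A. (\<forall>i\<in>S. v i = w i) \<longrightarrow> h v 0 = h w 0"
    using continuous_map_sft_local[OF h w, of 0] by (elim exE conjE)
  \<comment> \<open>Large enough that agreement up to \<open>n\<close> covers all of
    \<open>S\<close>, and at least \<open>m\<close>, so that coordinate \<open>m\<close> of a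
    covered point is an iterate of coordinate \<open>n\<close>.\<close>
  define n where "n = Max (insert m ((\<lambda>i. nat i) ` S))"
  have fin: "finite (insert m ((\<lambda>i. nat i) ` S))" using S(1) by simp
  have nm: "m \<le> n" unfolding n_def by (rule Max_ge[OF fin]) simp
  have nS: "i \<le> int n" if "i \<in> S" for i
  proof -
    have "nat i \<le> n" unfolding n_def using that by (intro Max_ge[OF fin]) auto
    then show ?thesis by simp
  qed
  let ?J = "itinerary f (\<lambda>j. w (- int n + int j)) (2 * n)"
  show ?thesis
  \<comment> \<open>The offset \<open>n - m\<close> carries coordinate \<open>n\<close> to
    coordinate \<open>m\<close>, which \<open>r\<close> maps to coordinate 0 of the induced
    point.\<close>
  proof (rule unique_letter[OF X.sft_admissible[OF w], where j="n - m" and n="2 * n"])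
    show "m + (n - m) \<le> Suc (2 * n)" using nm by simp
    show "h w 0 \<in> B" using hs[OF w] by (simp add: sft_def)
    show "block_code f r B m w 0 \<in> B" by (rule block_code_letter[OF w])
  next
    fix x assume x: "x \<in> ?J"
    show "r ((f ^^ (n - m)) x) \<in> block_code f r B m w 0"
      using block_code_image_iter[OF w x, of "n - m"] nm by (simp add: algebra_simps of_nat_diff)
    obtain v where v: "v \<in> sft f A" "\<And>k. k \<le> int n \<Longrightarrow> v k = w k" "cover_map X f v n = x"
      using X.sft_extension[OF w x] by blast
    have "h v 0 = h w 0" using S(2)[rule_format, OF v(1)] v(2) nS by simp
    moreover have "cover_map Y g (h v) 0 \<in> h v 0"
      using Y.cover_map_in[OF hs[OF v(1)], of 0 0] by simp
    moreover have "cover_map Y g (h v) 0 = r (cover_map X f v m)"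
      using lift[OF v(1)] by (simp add: induced_map_def)
    moreover have "cover_map X f v m = (f ^^ (n - m)) x"
      using inv_limit_iterate[OF X.cover_map_inv_limit[OF v(1)], of "n - m" m] v(3) nm by simp
    ultimately show "r ((f ^^ (n - m)) x) \<in> h w 0" by simp
  qed
qed

text \<open>Commuting with the shift reduces coordinate \<open>k\<close> to coordinate 0, settled by
  \<open>lift_letter\<close>.\<close>

lemma lift_unique:
  assumes h: "conjugacy (sft_topology f A) shift_map (sft_topology g B) shift_map h"
    and lift: "\<And>w. w \<in> sft f A \<Longrightarrow> cover_map Y g (h w) = induced_map m r (cover_map X f w)"
    and w: "w \<in> sft f A"
  shows "h w = block_code f r B m w"
proof
  fix k
  have hc: "continuous_map (sft_topology f A) (sft_topology g B) h"
    using h by (simp add: conjugacy_def homeomorphic_imp_continuous_map)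
  have step: "h (\<lambda>i. v (i + 1)) = (\<lambda>i. h v (i + 1))" if "v \<in> sft f A" for v
    using h that by (simp add: conjugacy_def topspace_sft_topology shift_map_def)
  have pos: "h (\<lambda>i. v (i + int n)) = (\<lambda>i. h v (i + int n))" if "v \<in> sft f A" for v n
  proof (induction n)
    case (Suc n)
    have "h (\<lambda>i. v (i + int (Suc n))) = h (\<lambda>i. (\<lambda>i. v (i + int n)) (i + 1))"
      by (simp add: algebra_simps)
    also have "\<dots> = (\<lambda>i. h v (i + int (Suc n)))"
      by (subst step[OF shift_sft[OF that]]) (simp add: Suc algebra_simps)
    finally show ?case .
  qed simp
  have "h (\<lambda>i. w (i + k)) = (\<lambda>i. h w (i + k))"
  proof (cases "k \<ge> 0")
    case True
    then show ?thesis using pos[OF w, of "nat k"] by simp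
  next
    case False
    \<comment> \<open>For negative \<open>k\<close> the word is first moved by \<open>k\<close> and
      then brought back by a positive shift.\<close>
    have "h (\<lambda>i. w (i + k + int (nat (- k)))) = (\<lambda>i. h (\<lambda>i. w (i + k)) (i + int (nat (- k))))"
      using pos[OF shift_sft[OF w, of k], of "nat (- k)"] by (simp add: algebra_simps)
    then have eq: "h w = (\<lambda>i. h (\<lambda>i. w (i + k)) (i - k))" using False by simp
    show ?thesis by (rule ext) (subst eq, simp)
  qed
  then have "h w k = h (\<lambda>i. w (i + k)) 0" by simp
  also have "\<dots> = block_code f r B m (\<lambda>i. w (i + k)) 0"
    by (rule lift_letter[OF hc lift shift_sft[OF w]])
  also have "\<dots> = block_code f r B m w k" by (simp add: block_code_shift)
  finally show "h w k = block_code f r B m w k" .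
qed

section \<open>The induced conjugacy of inverse limits\<close>

lemma induced_map_inv_limit:
  assumes "x \<in> inv_limit X f" shows "induced_map n r x \<in> inv_limit Y g"
  using assms r_space r_comm by (auto simp: inv_limit_def induced_map_def) (metis r_comm)

lemma induced_map_continuous: "continuous_on (inv_limit X f) (induced_map n r)"
  unfolding induced_map_def
proof (rule continuous_on_coordinatewise_then_product)
  fix i
  show "continuous_on (inv_limit X f) (\<lambda>x. r (x (n + i)))"
    by (rule continuous_on_compose2[OF r_cont])
      (auto simp: inv_limit_def intro: continuous_on_subset[OF continuous_on_product_coordinates])
qed

text \<open>The inverse is \<open>induced_map 0 s\<close>: composing gives the \<open>m\<close>-th
  iterate applied \<open>m\<close> coordinates further on, which returns the original
  coordinate.\<close>

lemma induced_map_conjugacy: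
  "conjugacy (top_of_set (inv_limit X f)) (inv_limit_map f)
     (top_of_set (inv_limit Y g)) (inv_limit_map g) (induced_map m r)"
proof -
  interpret S: cover_pair Y g B X f A s r m by (rule swap)
  have x_space: "x i \<in> space_of X" if "x \<in> inv_limit X f" for x i using that by (simp add: inv_limit_def)
  have y_space: "y i \<in> space_of Y" if "y \<in> inv_limit Y g" for y i using that by (simp add: inv_limit_def)
  have "homeomorphic_maps (top_of_set (inv_limit X f)) (top_of_set (inv_limit Y g))
      (induced_map m r) (induced_map 0 s)"
    unfolding homeomorphic_maps_def topspace_euclidean_subtopology continuous_map_in_subtopology
      continuous_map_iff_continuous
  proof (intro conjI ballI)
    show "induced_map 0 s (induced_map m r x) = x" if x: "x \<in> inv_limit X f" for x
      using s_r[OF x_space[OF x]] inv_limit_iterate[OF x] by (simp add: induced_map_def)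
    show "induced_map m r (induced_map 0 s y) = y" if y: "y \<in> inv_limit Y g" for y
      using r_s[OF y_space[OF y]] inv_limit_iterate[OF y] by (simp add: induced_map_def)
  qed (auto intro: induced_map_continuous S.induced_map_continuous induced_map_inv_limit S.induced_map_inv_limit)
  moreover have "induced_map m r (inv_limit_map f x) = inv_limit_map g (induced_map m r x)"
    if x: "x \<in> inv_limit X f" for x
  proof
    fix i
    have fx: "f (x (Suc i)) = x i" for i using x by (simp add: inv_limit_def)
    \<comment> \<open>On the inverse limit the shift acts as \<open>f\<close> in each coordinate, so
      commutation with \<open>r\<close> can be checked coordinatewise.\<close>
    have "inv_limit_map f x j = f (x j)" for j
      using fx by (cases j) (simp_all add: inv_limit_map_def)
    moreover have "inv_limit_map g (induced_map m r x) i = g (induced_map m r x i)"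
      using induced_map_inv_limit[OF x] by (cases i) (simp_all add: inv_limit_map_def inv_limit_def)
    ultimately show "induced_map m r (inv_limit_map f x) i = inv_limit_map g (induced_map m r x) i"
      using r_comm[OF x_space[OF x]] by (simp add: induced_map_def)
  qed
  ultimately show ?thesis
    unfolding conjugacy_def homeomorphic_map_maps by auto
qed

end

theorem theorem3p8:
  fixes X :: "'a::t2_space top_graph" and Y :: "'b::t2_space top_graph"
    and f :: "'a \<Rightarrow> 'a" and g :: "'b \<Rightarrow> 'b"
    and r :: "'a \<Rightarrow> 'b" and s :: "'b \<Rightarrow> 'a" and m :: nat
    and A :: "'a set set" and B :: "'b set set"
  assumes "expanding_graph_system X f"
    and "expanding_graph_system Y g"
    and "shift_equivalent_by X f Y g m r s"
    and "graph_map X Y r"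
    and "graph_map Y X s"
    and "sft_alphabet X f A"
    and "sft_alphabet Y g B"
  shows "conjugacy (top_of_set (inv_limit X f)) (inv_limit_map f)
                   (top_of_set (inv_limit Y g)) (inv_limit_map g) (induced_map m r) \<and>
         (\<exists>!h. h \<in> extensional (sft f A) \<and>
               conjugacy (sft_topology f A) shift_map (sft_topology g B) shift_map h \<and>
               (\<forall>w\<in>sft f A. cover_map Y g (h w) = induced_map m r (cover_map X f w)))"
proof -
  interpret cover_pair X f A Y g B r s m
    using assms by unfold_locales
  show ?thesis
  \<comment> \<open>Restriction fixes the values outside the subshift, so agreement on the subshift
    becomes equality of functions.\<close>
  proof (intro conjI induced_map_conjugacy ex1I[of _ "restrict (block_code f r B m) (sft f A)"])
    show "\<forall>w\<in>sft f A. cover_map Y g (restrict (block_code f r B m) (sft f A) w) =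
        induced_map m r (cover_map X f w)"
      using cover_map_block_code by simp
  next
    fix h assume h: "h \<in> extensional (sft f A) \<and>
      conjugacy (sft_topology f A) shift_map (sft_topology g B) shift_map h \<and>
      (\<forall>w\<in>sft f A. cover_map Y g (h w) = induced_map m r (cover_map X f w))"
    then show "h = restrict (block_code f r B m) (sft f A)"
      using lift_unique by (intro extensionalityI[of _ "sft f A"]) auto
  qed (auto intro: block_code_conjugacy)
qed

end
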